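(* For $t\in\mathbb{R}$, $m,n\in\mathbb{N}$, a weight $w$, and coefficients $c^L_{I,J}$ with $|c^L_{I,J}|\le \sqrt{|I|\,|J|}/|L|$ for all $L\in\mathcal{D}$, $I\in\mathcal{D}_n(L)$, $J\in\mathcal{D}_m(L)$, let $$T^{m,n}_{t,w}f(x)=\sum_{L\in\mathcal{D}}\ \sum_{\substack{I\in\mathcal{D}_n(L)\\ J\in\mathcal{D}_m(L)}} c^L_{I,J}\,\frac{w^t(x)}{(m_Lw)^t}\,\langle f,h_I\rangle\, h_J(x)$$ be the corresponding $t$-Haar multiplier of complexity $(m,n)$. (1) There is a numerical constant $C>0$ such that if $w\in C^d_{2t}$ and $w^{2t}\in A_2^d$, then for all $f\in L^2(\mathbb{R})$, $$\|T^{m,n}_{t,w}f\|_2\le C\,(m+n+2)^3\,[w]_{C^d_{2t}}^{1/2}\,[w^{2t}]_{A_2^d}^{1/2}\,\|f\|_2 .$$ (2) If $c^L_{I,J}=\sqrt{|I|\,|J|}/|L|$ for all $L,I,J$, then the condition $w\in C^d_{2t}$ is necessary for the boundedness of $T^{m,n}_{t,w}$ on $L^2(\mathbb{R})$.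
   Context: $\mathbb{N}$ includes $0$. $\mathcal{D}$ is the collection of all dyadic intervals $[k2^{-j},(k+1)2^{-j})\subset\mathbb{R}$, $j,k\in\mathbb{Z}$. For $L\in\mathcal{D}$, $\mathcal{D}_n(L)$ is the set of dyadic intervals $I\subset L$ with $|I|=2^{-n}|L|$, where $|I|$ is the length of $I$. For an interval $I$, $m_If=\frac1{|I|}\int_I f(x)\,dx$. The Haar function of $I\in\mathcal{D}$ is $h_I=|I|^{-1/2}(\chi_{I_+}-\chi_{I_-})$, where $I_+,I_-$ are the right and left halves of $I$, and $\langle f,g\rangle=\int_{\mathbb{R}} f\overline{g}\,dx$. $\|\cdot\|_2$ is the norm of $L^2(\mathbb{R})$. A weight is a locally integrable function on $\mathbb{R}$ that is positive almost everywhere. A weight $v$ belongs to $A_2^d$ if $[v]_{A_2^d}:=\sup_{I\in\mathcal{D}}(m_Iv)(m_Iv^{-1})<\infty$. For $s\in\mathbb{R}$, a weight $w$ belongs to $C^d_s$ if $[w]_{C^d_s}:=\sup_{I\in\mathcal{D}}(m_Iw^s)(m_Iw)^{-s}<\infty$. *)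

theory Defs
  imports "HOL-Analysis.Analysis"
begin

section \<open>Dyadic intervals and Haar functions\<close>

definition dyadic :: "real set set" where
  "dyadic = {{of_int k * 2 powi (- j) ..< (of_int k + 1) * 2 powi (- j)} | k j :: int. True}"

abbreviation len :: "real set \<Rightarrow> real" where
  "len I \<equiv> measure lebesgue I"

definition dyadic_sub :: "nat \<Rightarrow> real set \<Rightarrow> real set set" where
  "dyadic_sub n L = {I \<in> dyadic. I \<subseteq> L \<and> len I = (1 / 2) ^ n * len L}"

definition left_half :: "real set \<Rightarrow> real set" where
  "left_half I = {Inf I ..< (Inf I + Sup I) / 2}"

definition right_half :: "real set \<Rightarrow> real set" where
  "right_half I = {(Inf I + Sup I) / 2 ..< Sup I}"

definition haar :: "real set \<Rightarrow> real \<Rightarrow> complex" where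
  "haar I x = complex_of_real
     (1 / sqrt (len I) * (indicat_real (right_half I) x - indicat_real (left_half I) x))"


section \<open>The space of square integrable functions\<close>

definition L2 :: "(real \<Rightarrow> complex) set" where
  "L2 = {f \<in> borel_measurable lebesgue. integrable lebesgue (\<lambda>x. (cmod (f x))\<^sup>2)}"

definition L2_norm :: "(real \<Rightarrow> complex) \<Rightarrow> real" where
  "L2_norm f = sqrt (LINT x|lebesgue. (cmod (f x))\<^sup>2)"

definition L2_inner :: "(real \<Rightarrow> complex) \<Rightarrow> (real \<Rightarrow> complex) \<Rightarrow> complex" where
  "L2_inner f g = (LINT x|lebesgue. f x * cnj (g x))"

text \<open>Unconditional convergence of a series of functions in the \<open>L2\<close> norm. The distance is
  measured with the nonnegative integral, so that it is infinite (rather than 0, the value of the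
  Bochner integral) when a partial sum is not square integrable.\<close>

definition has_L2_sum :: "('a \<Rightarrow> real \<Rightarrow> complex) \<Rightarrow> 'a set \<Rightarrow> (real \<Rightarrow> complex) \<Rightarrow> bool" where
  "has_L2_sum u A g \<longleftrightarrow> g \<in> L2 \<and>
     ((\<lambda>F. \<integral>\<^sup>+ x. ennreal ((cmod ((\<Sum>a\<in>F. u a x) - g x))\<^sup>2) \<partial>lebesgue) \<longlongrightarrow> 0)
       (finite_subsets_at_top A)"


section \<open>Weights\<close>

definition weight :: "(real \<Rightarrow> real) \<Rightarrow> bool" where
  "weight w \<longleftrightarrow> (\<forall>K. compact K \<longrightarrow> set_integrable lebesgue K w) \<and> (AE x in lebesgue. 0 < w x)"

definition mean :: "real set \<Rightarrow> (real \<Rightarrow> real) \<Rightarrow> real" where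
  "mean I f = 1 / len I * (LINT x:I|lebesgue. f x)"

text \<open>The mean of a nonnegative function that need not be locally integrable, such as a power
  of a weight; it may be infinite.\<close>

definition emean :: "real set \<Rightarrow> (real \<Rightarrow> real) \<Rightarrow> ennreal" where
  "emean I f = (\<integral>\<^sup>+ x\<in>I. ennreal (f x) \<partial>lebesgue) / ennreal (len I)"

definition A2_const :: "(real \<Rightarrow> real) \<Rightarrow> ennreal" where
  "A2_const v = (SUP I\<in>dyadic. emean I v * emean I (\<lambda>x. inverse (v x)))"

definition A2d :: "(real \<Rightarrow> real) set" where
  "A2d = {v. weight v \<and> A2_const v < \<infinity>}"

definition C_const :: "real \<Rightarrow> (real \<Rightarrow> real) \<Rightarrow> ennreal" where
  "C_const s w = (SUP I\<in>dyadic. emean I (\<lambda>x. w x powr s) * ennreal (mean I w powr (- s)))"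

definition Cd :: "real \<Rightarrow> (real \<Rightarrow> real) set" where
  "Cd s = {w. weight w \<and> C_const s w < \<infinity>}"


section \<open>Haar multipliers\<close>

definition haar_mult_term ::
  "real \<Rightarrow> nat \<Rightarrow> nat \<Rightarrow> (real \<Rightarrow> real) \<Rightarrow> (real set \<Rightarrow> real set \<Rightarrow> real set \<Rightarrow> complex) \<Rightarrow>
   (real \<Rightarrow> complex) \<Rightarrow> real set \<Rightarrow> real \<Rightarrow> complex" where
  "haar_mult_term t m n w c f L x =
     (\<Sum>I\<in>dyadic_sub n L. \<Sum>J\<in>dyadic_sub m L.
        c L I J * complex_of_real (w x powr t / mean L w powr t) * L2_inner f (haar I) * haar J x)"

text \<open>The multiplier as a relation: the defining series at \<open>f\<close> converges to \<open>g\<close>, which is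
  therefore determined almost everywhere by \<open>f\<close>.\<close>

definition haar_mult ::
  "real \<Rightarrow> nat \<Rightarrow> nat \<Rightarrow> (real \<Rightarrow> real) \<Rightarrow> (real set \<Rightarrow> real set \<Rightarrow> real set \<Rightarrow> complex) \<Rightarrow>
   (real \<Rightarrow> complex) \<Rightarrow> (real \<Rightarrow> complex) \<Rightarrow> bool" where
  "haar_mult t m n w c f g \<longleftrightarrow> has_L2_sum (haar_mult_term t m n w c f) dyadic g"

definition haar_mult_bounded_by ::
  "real \<Rightarrow> nat \<Rightarrow> nat \<Rightarrow> (real \<Rightarrow> real) \<Rightarrow> (real set \<Rightarrow> real set \<Rightarrow> real set \<Rightarrow> complex) \<Rightarrow>
   real \<Rightarrow> bool" where
  "haar_mult_bounded_by t m n w c K \<longleftrightarrow>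
     (\<forall>f\<in>L2. \<exists>g. haar_mult t m n w c f g \<and> L2_norm g \<le> K * L2_norm f)"

end

theory Submission imports Defs begin

text \<open>Put \<open>v = w\<^sup>2\<^sup>t\<close>. A finite partial sum of the multiplier is \<open>w\<^sup>t P\<close>, where \<open>P\<close> is a finite sum of
Haar functions whose block at \<open>L\<close> carries the factor \<open>a(L)\<close>, the mean of \<open>w\<close> over \<open>L\<close> to the power
\<open>-t\<close>. The condition on \<open>w\<close> says exactly that \<open>a(L)\<^sup>2\<close> is at most a constant divided by the mean
of \<open>v\<close> over \<open>L\<close>, so only the single weight \<open>v\<close> matters from here on.

The quantity to bound is the integral of \<open>|P|\<^sup>2 v\<close>, which is the pairing of \<open>P\<close> with \<open>G = P v\<close>.
Expanding \<open>P\<close> turns this pairing into a sum over \<open>L\<close>, \<open>I\<close>, \<open>J\<close> of Haar coefficients of \<open>f\<close> against Haar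
coefficients of \<open>G\<close>. The sizes of the \<open>J\<close>'s of one generation below \<open>L\<close>, weighted by the means of
\<open>v\<close>, add up to the size of \<open>L\<close> times the mean of \<open>v\<close> over \<open>L\<close>. By Cauchy-Schwarz the sum over
\<open>J\<close> is therefore at most the square root of that mean, which \<open>a(L)\<close> cancels, times the square root
of the sum of \<open>|\<langle>G, h\<^sub>J\<rangle>|\<^sup>2\<close> divided by the mean of \<open>v\<close> over \<open>J\<close>
(\<open>haar_coefficients_weighted_Cauchy_Schwarz\<close>). The sum over \<open>I\<close> is the case \<open>v = 1\<close> of the same
inequality. Since an interval has only one ancestor of a given generation, summing over \<open>L\<close> counts
each \<open>I\<close> and each \<open>J\<close> once, and the bound does not depend on the complexity.

What remains is the weighted square function estimate (\<open>square_function_estimate\<close>): the sum of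
\<open>|\<langle>g, h\<^sub>J\<rangle>|\<^sup>2\<close> divided by the mean of \<open>v\<close> over \<open>J\<close> is at most a numerical constant times the \<open>A\<^sub>2\<close>
constant of \<open>v\<close> times the integral of \<open>|g|\<^sup>2 / v\<close>. It is linear in the \<open>A\<^sub>2\<close> constant, and it is
proved with an explicit Bellman function: a function of the means of \<open>g\<close>, \<open>v\<close> and \<open>1 / v\<close> over an
interval which, when the interval is halved, grows on average by at least the contribution of that
interval to the square function (\<open>bellman_gap\<close>). Applied to \<open>G\<close> this gives
\<open>X \<le> const \<cdot> \<surd>X\<close> for \<open>X\<close> the integral of \<open>|P|\<^sup>2 v\<close>; applied with \<open>v = 1\<close> it gives a Bessel inequality for
the coefficients of \<open>f\<close>. The bound for finite partial sums by a summable family then makes the series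
converge unconditionally in \<open>L\<^sup>2\<close> (\<open>has_L2_sum_if_dominated\<close>).

For the necessity, apply the operator to a single Haar function \<open>h\<^sub>I\<close> with \<open>I\<close> in the \<open>n\<close>-th
generation below \<open>L\<close>. By orthogonality only the block of \<open>L\<close> survives, and the Haar functions of one
generation have disjoint supports, so the image has modulus \<open>w\<^sup>t\<close> times a constant on \<open>L\<close>. Up
to the factor \<open>2\<^sup>-\<^sup>n\<close>, its squared norm is the quantity whose supremum over \<open>L\<close> is the constant
of \<open>w\<close>.\<close>

section \<open>A Bellman function\<close>

text \<open>The Taylor polynomial \<open>1 + b / 2 - b\<^sup>2 / 8\<close> is not an upper bound; halving its quadratic coefficient
makes it one on \<open>[-1, 1]\<close> and keeps the strict concavity.\<close>

lemma sqrt_one_plus_le: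
  fixes b :: real assumes "\<bar>b\<bar> \<le> 1"
  shows "sqrt (1 + b) \<le> 1 + b / 2 - b\<^sup>2 / 16"
proof (rule real_le_lsqrt)
  have "b\<^sup>2 \<le> 1" using assms by (simp add: abs_square_le_1)
  then show "0 \<le> 1 + b / 2 - b\<^sup>2 / 16" using assms by (simp add: abs_le_iff)
  have "b\<^sup>2 * (2 - b) \<ge> 0" using assms by (intro mult_nonneg_nonneg) auto
  moreover have "(1 + b / 2 - b\<^sup>2 / 16)\<^sup>2 = 1 + b + b\<^sup>2 * (2 - b) / 16 + (b\<^sup>2 / 16)\<^sup>2"
    by (simp add: power2_eq_square field_simps)
  ultimately show "1 + b \<le> (1 + b / 2 - b\<^sup>2 / 16)\<^sup>2" by simp
qed

text \<open>This is the second difference of \<open>sqrt (v / u)\<close> between a point and two points placed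
symmetrically about it, with relative displacements \<open>a\<close> of \<open>u\<close> and \<open>b\<close> of \<open>v\<close>. The function is
strictly concave in \<open>v\<close>, which gives the term in \<open>b\<^sup>2\<close>. It is not jointly concave, but the error is a
multiple of \<open>a\<^sup>2 / (1 - a\<^sup>2)\<close>, exactly the second difference of \<open>1 / u\<close>. A finite
difference, rather than a Hessian, is estimated because the region \<open>u v \<le> Q\<close> is not convex: the segment
between the two outer points may leave it.\<close>

lemma sqrt_ratio_gap:
  fixes a b :: real assumes a: "\<bar>a\<bar> < 1" and b: "\<bar>b\<bar> < 1"
  shows "(sqrt ((1 + b) / (1 + a)) + sqrt ((1 - b) / (1 - a))) / 2
           \<le> 1 + 3 / 2 * (a\<^sup>2 / (1 - a\<^sup>2)) - b\<^sup>2 / 32"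
proof -
  define p where "p = 1 / sqrt (1 + a)"
  define q where "q = 1 / sqrt (1 - a)"
  define e where "e = a\<^sup>2 / (1 - a\<^sup>2)"
  have a1: "1 + a > 0" "1 - a > 0" using a by auto
  have a2: "1 - a\<^sup>2 > 0" using a by (simp add: abs_square_less_1)
  have e0: "e \<ge> 0" unfolding e_def using a2 by simp
  have pq0: "p > 0" "q > 0" using a1 by (auto simp: p_def q_def)
  have p2: "p\<^sup>2 = 1 / (1 + a)" and q2: "q\<^sup>2 = 1 / (1 - a)"
    using a1 by (auto simp: p_def q_def power_divide)
  have fac: "1 - a\<^sup>2 = (1 + a) * (1 - a)" by (simp add: power2_eq_square algebra_simps)
  have e1: "1 + e = 1 / ((1 + a) * (1 - a))"
    using a2 unfolding e_def fac[symmetric] by (simp add: field_simps)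
  have s2: "p\<^sup>2 + q\<^sup>2 = 2 * (1 + e)"
    using a1 unfolding p2 q2 e1 by (simp add: divide_simps)
  have pq2: "(p * q)\<^sup>2 = 1 + e"
    unfolding power_mult_distrib p2 q2 e1 by simp
  have pq: "p * q \<ge> 1"
    using pq2 e0 pq0 by (intro power2_le_imp_le[of 1]) auto
  have sum_ge: "p + q \<ge> 2"
  proof (rule power2_le_imp_le)
    show "2\<^sup>2 \<le> (p + q)\<^sup>2" using s2 pq e0 by (simp add: power2_sum)
  qed (use pq0 in auto)
  have sum_le: "p + q \<le> 2 + e"
  proof (rule power2_le_imp_le)
    have "(p + q)\<^sup>2 \<le> 2 * (p\<^sup>2 + q\<^sup>2)" using sum_squares_bound[of p q] by (simp add: power2_sum)
    also have "\<dots> \<le> (2 + e)\<^sup>2" using s2 e0 by (simp add: power2_sum)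
    finally show "(p + q)\<^sup>2 \<le> (2 + e)\<^sup>2" .
  qed (use e0 in auto)
  have diff: "(p - q)\<^sup>2 \<le> 2 * e"
    using s2 pq by (simp add: power2_diff)
  have B1: "sqrt ((1 + b) / (1 + a)) \<le> (1 + b / 2 - b\<^sup>2 / 16) * p"
    using sqrt_one_plus_le[of b] b pq0 by (simp add: real_sqrt_divide p_def divide_right_mono a1 less_imp_le)
  have B2: "sqrt ((1 - b) / (1 - a)) \<le> (1 - b / 2 - b\<^sup>2 / 16) * q"
    using sqrt_one_plus_le[of "-b"] b pq0 by (simp add: real_sqrt_divide q_def divide_right_mono a1 less_imp_le)
  have "b * (p - q) \<le> b\<^sup>2 / 8 + 2 * (p - q)\<^sup>2"
    using zero_le_power2[of "b - 4 * (p - q)"]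
    by (simp add: power2_eq_square algebra_simps)
  then have cross: "b * (p - q) \<le> b\<^sup>2 / 8 + 4 * e" using diff by linarith
  have quad: "b\<^sup>2 * (p + q) \<ge> b\<^sup>2 * 2" using sum_ge by (intro mult_left_mono) auto
  have "(1 + b / 2 - b\<^sup>2 / 16) * p + (1 - b / 2 - b\<^sup>2 / 16) * q
      = (p + q) + b * (p - q) / 2 - b\<^sup>2 * (p + q) / 16" by (simp add: field_simps)
  then show ?thesis using B1 B2 cross quad sum_le e0 unfolding e_def[symmetric] by argo
qed

text \<open>A multiple of \<open>v\<close> corrected so that it is strictly concave in the direction of \<open>v\<close>: the square root
provides the concavity wherever \<open>u v \<le> Q\<close>, the term \<open>- 3 / 2 \<cdot> 1 / u\<close> absorbs the failure of concavity in \<open>u\<close>,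
with the constant \<open>3 / 2\<close> from \<open>sqrt_ratio_gap\<close>, and \<open>5 / 2 \<cdot> v\<close> keeps the whole comparable with \<open>v\<close>.
Here \<open>u\<close> stands for the mean of \<open>1 / v\<close>, and \<open>Q\<close> for the \<open>A\<^sub>2\<close> constant.\<close>

definition bellman_den :: "real \<Rightarrow> real \<Rightarrow> real \<Rightarrow> real" where
  "bellman_den Q v u = 5 / 2 * v - 3 / 2 * (1 / u) + sqrt (v / (Q * u))"

lemma bellman_den_bounds:
  fixes v u Q :: real
  assumes "v > 0" "u > 0" "1 \<le> v * u" "1 \<le> Q"
  shows "v \<le> bellman_den Q v u" "bellman_den Q v u \<le> 7 / 2 * v"
proof -
  have iu: "1 / u \<le> v" using assms by (simp add: field_simps)
  have "0 \<le> sqrt (v / (Q * u))" using assms by simp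
  then show "v \<le> bellman_den Q v u" using iu unfolding bellman_den_def by linarith
  have "sqrt (v / (Q * u)) \<le> v"
  proof (rule real_le_lsqrt)
    have "1 / (Q * u) \<le> v" using assms iu
      by (smt (verit, best) frac_le mult_le_cancel_right1)
    then have "v * (1 / (Q * u)) \<le> v * v" using assms by (intro mult_left_mono) auto
    then show "v / (Q * u) \<le> v\<^sup>2" by (simp add: power2_eq_square)
  qed (use assms in auto)
  moreover have "0 \<le> 1 / u" using assms by simp
  ultimately show "bellman_den Q v u \<le> 7 / 2 * v" unfolding bellman_den_def by linarith
qed

text \<open>With \<open>Z = sqrt (v / (Q u))\<close>, the condition \<open>u v \<le> Q\<close> is equivalent to each of \<open>Z \<le> 1 / u\<close> and
\<open>v / Q \<le> Z\<close>. The first makes the error of \<open>sqrt_ratio_gap\<close> smaller than the gain from \<open>- 1 / u\<close>; the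
second turns the gain \<open>Z b\<^sup>2 / 32\<close> into one of size \<open>v b\<^sup>2 / Q\<close>.\<close>

lemma bellman_den_gap:
  fixes v u v1 v2 u1 u2 Q :: real
  assumes pos: "v1 > 0" "v2 > 0" "u1 > 0" "u2 > 0" "Q > 0"
    and v: "v = (v1 + v2) / 2" and u: "u = (u1 + u2) / 2" and Q: "v * u \<le> Q"
  shows "(bellman_den Q v1 u1 + bellman_den Q v2 u2) / 2 + ((v1 - v2) / 2)\<^sup>2 / (32 * Q * v)
           \<le> bellman_den Q v u"
proof -
  define a where "a = (u1 - u2) / (u1 + u2)"
  define b where "b = (v1 - v2) / (v1 + v2)"
  define e where "e = a\<^sup>2 / (1 - a\<^sup>2)"
  define Z where "Z = sqrt (v / (Q * u))"
  have vu: "v > 0" "u > 0" using pos v u by auto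
  have ab: "\<bar>a\<bar> < 1" "\<bar>b\<bar> < 1" using pos by (auto simp: a_def b_def abs_less_iff field_simps)
  have u12: "u1 = u * (1 + a)" "u2 = u * (1 - a)" and v12: "v1 = v * (1 + b)" "v2 = v * (1 - b)"
    using pos by (auto simp: u v a_def b_def field_simps)
  have a1: "1 + a > 0" "1 - a > 0" using ab by auto
  have a2: "1 - a\<^sup>2 > 0" using ab by (simp add: abs_square_less_1)
  have e0: "e \<ge> 0" unfolding e_def using a2 by simp
  have fac: "1 - a\<^sup>2 = (1 + a) * (1 - a)" by (simp add: power2_eq_square algebra_simps)
  have e1: "1 + e = 1 / ((1 + a) * (1 - a))"
    using a2 unfolding e_def fac[symmetric] by (simp add: field_simps)
  have inv: "(1 / u1 + 1 / u2) / 2 = 1 / u + e / u"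
  proof -
    have "(1 / u1 + 1 / u2) / 2 = 1 / u * (1 / ((1 + a) * (1 - a)))"
      using a1 vu unfolding u12 by (simp add: divide_simps)
    then show ?thesis unfolding e1[symmetric] by (simp add: add_divide_distrib)
  qed
  have r1: "sqrt (v1 / (Q * u1)) = Z * sqrt ((1 + b) / (1 + a))"
    unfolding Z_def u12 v12 real_sqrt_mult[symmetric] by simp
  have r2: "sqrt (v2 / (Q * u2)) = Z * sqrt ((1 - b) / (1 - a))"
    unfolding Z_def u12 v12 real_sqrt_mult[symmetric] by simp
  have Z0: "Z \<ge> 0" using vu pos by (simp add: Z_def)
  have rs: "(sqrt (v1 / (Q * u1)) + sqrt (v2 / (Q * u2))) / 2 \<le> Z * (1 + 3 / 2 * e - b\<^sup>2 / 32)"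
    using mult_left_mono[OF sqrt_ratio_gap[OF ab] Z0]
    unfolding r1 r2 e_def by (simp add: algebra_simps)
  have Zu: "Z \<le> 1 / u"
    unfolding Z_def
  proof (rule real_le_lsqrt)
    show "v / (Q * u) \<le> (1 / u)\<^sup>2" using Q vu pos by (simp add: power2_eq_square field_simps)
  qed (use vu in auto)
  have Zl: "v / Q \<le> Z"
    unfolding Z_def
  proof (rule real_le_rsqrt)
    have "v * (v * u) \<le> v * Q" using Q vu by (intro mult_left_mono) auto
    then show "(v / Q)\<^sup>2 \<le> v / (Q * u)" using vu pos by (simp add: power2_eq_square field_simps)
  qed
  define p q where "p = v / Q * b\<^sup>2" and "q = e / u"
  have "Z * e \<le> q" using mult_right_mono[OF Zu e0] by (simp add: q_def)
  moreover have "p \<le> Z * b\<^sup>2" unfolding p_def using Zl by (intro mult_right_mono) auto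
  moreover have "((v1 - v2) / 2)\<^sup>2 / (32 * Q * v) = v / Q * b\<^sup>2 / 32"
  proof -
    have "(v1 - v2) / 2 = v * b" unfolding v12 by (simp add: algebra_simps)
    then show ?thesis using vu pos by (simp add: power2_eq_square field_simps)
  qed
  moreover have "(bellman_den Q v1 u1 + bellman_den Q v2 u2) / 2
      = 5 / 2 * v - 3 / 2 * ((1 / u1 + 1 / u2) / 2)
        + (sqrt (v1 / (Q * u1)) + sqrt (v2 / (Q * u2))) / 2"
    unfolding bellman_den_def v by (simp add: field_simps)
  moreover have "bellman_den Q v u = 5 / 2 * v - 3 / 2 * (1 / u) + Z"
    by (simp add: bellman_den_def Z_def)
  moreover have "Z * (1 + 3 / 2 * e - b\<^sup>2 / 32) = Z + 3 / 2 * (Z * e) - Z * b\<^sup>2 / 32"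
    by (simp add: algebra_simps)
  ultimately show ?thesis using rs unfolding inv p_def[symmetric] q_def[symmetric] by argo
qed

text \<open>The function \<open>g\<^sup>2 / v\<close> is convex, but linear along rays, so its gap sees only the part \<open>d - g b\<close> of the
increment \<open>d\<close> of \<open>g\<close> that is transversal to the ray.\<close>

lemma square_over_gap:
  fixes g1 g2 v1 v2 :: real
  assumes "v1 > 0" "v2 > 0"
  defines "g \<equiv> (g1 + g2) / 2" and "d \<equiv> (g1 - g2) / 2" and "v \<equiv> (v1 + v2) / 2"
    and "b \<equiv> (v1 - v2) / (v1 + v2)"
  shows "g\<^sup>2 / v + (d - g * b)\<^sup>2 / v \<le> (g1\<^sup>2 / v1 + g2\<^sup>2 / v2) / 2"
proof -
  have v0: "v > 0" using assms by simp
  have b1: "\<bar>b\<bar> < 1" using assms(1,2) by (auto simp: b_def abs_less_iff field_simps)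
  have v12: "v1 = v * (1 + b)" "v2 = v * (1 - b)"
    using assms(1,2) by (auto simp: v_def b_def field_simps)
  have g12: "g1 = g + d" "g2 = g - d" by (auto simp: g_def d_def field_simps)
  have pos: "1 + b > 0" "1 - b > 0" using b1 by auto
  have b2: "0 < (1 + b) * (1 - b)" "(1 + b) * (1 - b) \<le> 1"
    using pos by (simp, simp add: algebra_simps)
  have "(g1\<^sup>2 / v1 + g2\<^sup>2 / v2) / 2 - g\<^sup>2 / v = (d - g * b)\<^sup>2 / (v * ((1 + b) * (1 - b)))"
    using pos v0 unfolding g12 v12 by (simp add: divide_simps) algebra
  moreover have "(d - g * b)\<^sup>2 / v \<le> (d - g * b)\<^sup>2 / (v * ((1 + b) * (1 - b)))"
    using v0 b2 by (intro divide_left_mono) (auto simp: mult_le_cancel_left1)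
  ultimately show ?thesis by linarith
qed

text \<open>The argument \<open>s\<close> is the square of the mean of \<open>g\<close>. The gap of \<open>s / v\<close> controls the increment of \<open>g\<close>
minus \<open>g / v\<close> times the increment of \<open>v\<close>; the second summand pays for what was subtracted. The
factor is \<open>392 = 32 \<cdot> (7 / 2)\<^sup>2\<close>, with \<open>32\<close> from \<open>bellman_den_gap\<close> and \<open>7 / 2\<close> from
\<open>bellman_den_bounds\<close>.\<close>

definition bellman :: "real \<Rightarrow> real \<Rightarrow> real \<Rightarrow> real \<Rightarrow> real" where
  "bellman Q s v u = s / v + 392 * Q * (s / bellman_den Q v u)"

lemma bellman_le:
  assumes "v > 0" "u > 0" "1 \<le> v * u" "1 \<le> Q" "s \<ge> 0"
  shows "bellman Q s v u \<le> 393 * Q * (s / v)"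
proof -
  have "s / bellman_den Q v u \<le> s / v"
    using bellman_den_bounds[OF assms(1-4)] assms by (intro divide_left_mono) auto
  then have "392 * Q * (s / bellman_den Q v u) \<le> 392 * Q * (s / v)"
    using assms by (intro mult_left_mono) auto
  moreover have "1 * (s / v) \<le> Q * (s / v)" using assms by (intro mult_right_mono) auto
  ultimately show ?thesis unfolding bellman_def by linarith
qed

lemma bellman_nonneg:
  assumes "v > 0" "u > 0" "1 \<le> v * u" "1 \<le> Q" "s \<ge> 0"
  shows "0 \<le> bellman Q s v u"
  using bellman_den_bounds[OF assms(1-4)] assms unfolding bellman_def by simp

text \<open>Since \<open>g\<^sup>2 / N\<close> is convex in \<open>(g, N)\<close> and decreasing in \<open>N\<close>, a concavity gap of \<open>N\<close> is passed on to
\<open>g\<^sup>2 / N\<close>, where it dominates \<open>(g b)\<^sup>2 / v\<close>. Together with the gap \<open>(d - g b)\<^sup>2 / v\<close> of \<open>g\<^sup>2 / v\<close> it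
dominates half of \<open>d\<^sup>2 / v\<close>.\<close>

lemma bellman_gap_real:
  fixes g1 g2 v v1 v2 u u1 u2 Q :: real
  assumes pos: "v1 > 0" "v2 > 0" "u1 > 0" "u2 > 0" "1 \<le> Q"
    and v: "v = (v1 + v2) / 2" and u: "u = (u1 + u2) / 2" and Q: "v * u \<le> Q"
    and one: "1 \<le> v * u" "1 \<le> v1 * u1" "1 \<le> v2 * u2"
  shows "bellman Q (((g1 + g2) / 2)\<^sup>2) v u + ((g1 - g2) / 2)\<^sup>2 / v / 2
           \<le> (bellman Q (g1\<^sup>2) v1 u1 + bellman Q (g2\<^sup>2) v2 u2) / 2"
proof -
  define N N1 N2 where "N = bellman_den Q v u" and "N1 = bellman_den Q v1 u1"
    and "N2 = bellman_den Q v2 u2"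
  define b where "b = (v1 - v2) / (v1 + v2)"
  define g where "g = (g1 + g2) / 2"
  define d where "d = (g1 - g2) / 2"
  define \<delta> where "\<delta> = v * b\<^sup>2 / (32 * Q)"
  have vu: "v > 0" "u > 0" using pos v u by auto
  have N: "v \<le> N" "N \<le> 7 / 2 * v" "v1 \<le> N1" "v2 \<le> N2"
    using bellman_den_bounds[of v u Q] bellman_den_bounds[of v1 u1 Q] bellman_den_bounds[of v2 u2 Q]
      pos vu one by (auto simp: N_def N1_def N2_def)
  have N0: "N > 0" "N1 > 0" "N2 > 0" using N pos vu by auto
  have d0: "0 \<le> \<delta>" unfolding \<delta>_def using vu pos by simp
  have \<delta>: "((v1 - v2) / 2)\<^sup>2 / (32 * Q * v) = \<delta>"
  proof -
    have "(v1 - v2) / 2 = v * b" unfolding b_def v using pos by (simp add: field_simps)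
    then show ?thesis unfolding \<delta>_def using vu pos by (simp add: power2_eq_square field_simps)
  qed
  have avg: "(N1 + N2) / 2 \<le> N - \<delta>"
    using bellman_den_gap[OF pos(1-4) _ v u Q, unfolded \<delta>] pos(5)
    unfolding N_def N1_def N2_def by linarith
  have A0: "0 < (N1 + N2) / 2" using N0 by simp
  \<comment> \<open>First-order effect on \<open>1 / N\<close> of lowering \<open>N\<close> by \<open>\<delta>\<close>.\<close>
  have "(N - \<delta>) * (N + \<delta>) \<le> N\<^sup>2" by (simp add: power2_eq_square algebra_simps)
  then have "1 / N + \<delta> / N\<^sup>2 \<le> 1 / (N - \<delta>)"
    using N0 avg A0 by (simp add: divide_simps power2_eq_square) (simp add: algebra_simps)
  also have "\<dots> \<le> 1 / ((N1 + N2) / 2)" using avg A0 by (intro divide_left_mono) auto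
  finally have "g\<^sup>2 * (1 / N + \<delta> / N\<^sup>2) \<le> g\<^sup>2 * (1 / ((N1 + N2) / 2))" by (intro mult_left_mono) auto
  moreover have "g\<^sup>2 / ((N1 + N2) / 2) \<le> (g1\<^sup>2 / N1 + g2\<^sup>2 / N2) / 2"
    using square_over_gap[OF N0(2,3), of g1 g2] A0 unfolding g_def
    by (smt (verit) divide_nonneg_pos zero_le_power2)
  moreover have "g\<^sup>2 * (1 / N + \<delta> / N\<^sup>2) = g\<^sup>2 / N + g\<^sup>2 * \<delta> / N\<^sup>2"
    by (simp add: algebra_simps)
  ultimately have c1: "g\<^sup>2 / N + g\<^sup>2 * \<delta> / N\<^sup>2 \<le> (g1\<^sup>2 / N1 + g2\<^sup>2 / N2) / 2"
    unfolding mult.right_neutral times_divide_eq_right by linarith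
  have "(g * b)\<^sup>2 / v \<le> 392 * Q * (g\<^sup>2 * \<delta> / N\<^sup>2)"
  proof -
    have "N\<^sup>2 \<le> (7 / 2 * v)\<^sup>2" using N N0 by (intro power_mono) auto
    then have "g\<^sup>2 * \<delta> / (7 / 2 * v)\<^sup>2 \<le> g\<^sup>2 * \<delta> / N\<^sup>2"
      using N0 vu d0 by (intro divide_left_mono) auto
    then have "392 * Q * (g\<^sup>2 * \<delta> / (7 / 2 * v)\<^sup>2) \<le> 392 * Q * (g\<^sup>2 * \<delta> / N\<^sup>2)"
      using pos by (intro mult_left_mono) auto
    moreover have "392 * Q * (g\<^sup>2 * \<delta> / (7 / 2 * v)\<^sup>2) = (g * b)\<^sup>2 / v"
      unfolding \<delta>_def using vu pos by (simp add: power2_eq_square field_simps)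
    ultimately show ?thesis by simp
  qed
  moreover have "392 * Q * (g\<^sup>2 / N + g\<^sup>2 * \<delta> / N\<^sup>2) \<le> 392 * Q * ((g1\<^sup>2 / N1 + g2\<^sup>2 / N2) / 2)"
    using c1 pos by (intro mult_left_mono) auto
  ultimately have c2: "392 * Q * (g\<^sup>2 / N) + (g * b)\<^sup>2 / v \<le> 392 * Q * ((g1\<^sup>2 / N1 + g2\<^sup>2 / N2) / 2)"
    unfolding distrib_left by linarith
  have c3: "g\<^sup>2 / v + (d - g * b)\<^sup>2 / v \<le> (g1\<^sup>2 / v1 + g2\<^sup>2 / v2) / 2"
    using square_over_gap[OF pos(1,2), of g1 g2] unfolding g_def d_def b_def v .
  have "d\<^sup>2 / 2 \<le> (d - g * b)\<^sup>2 + (g * b)\<^sup>2"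
    using zero_le_power2[of "d - 2 * (g * b)"] by (simp add: power2_eq_square algebra_simps)
  then have "d\<^sup>2 / 2 / v \<le> ((d - g * b)\<^sup>2 + (g * b)\<^sup>2) / v" using vu by (intro divide_right_mono) auto
  then have "d\<^sup>2 / v / 2 \<le> (d - g * b)\<^sup>2 / v + (g * b)\<^sup>2 / v" by (simp add: add_divide_distrib)
  then show ?thesis using c2 c3
    unfolding bellman_def g_def[symmetric] d_def[symmetric] N_def[symmetric] N1_def[symmetric] N2_def[symmetric]
    by (simp add: algebra_simps)
qed

lemma bellman_gap:
  fixes g1 g2 :: complex and v v1 v2 u u1 u2 Q :: real
  assumes pos: "v1 > 0" "v2 > 0" "u1 > 0" "u2 > 0" "1 \<le> Q"
    and v: "v = (v1 + v2) / 2" and u: "u = (u1 + u2) / 2" and Q: "v * u \<le> Q"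
    and one: "1 \<le> v * u" "1 \<le> v1 * u1" "1 \<le> v2 * u2"
  shows "bellman Q ((cmod ((g1 + g2) / 2))\<^sup>2) v u + (cmod ((g1 - g2) / 2))\<^sup>2 / v / 2
           \<le> (bellman Q ((cmod g1)\<^sup>2) v1 u1 + bellman Q ((cmod g2)\<^sup>2) v2 u2) / 2"
proof -
  have add: "bellman Q (x + y) v u = bellman Q x v u + bellman Q y v u" for x y v u
    by (simp add: bellman_def add_divide_distrib algebra_simps)
  have mid: "(cmod ((g1 + g2) / 2))\<^sup>2 = ((Re g1 + Re g2) / 2)\<^sup>2 + ((Im g1 + Im g2) / 2)\<^sup>2"
    "(cmod ((g1 - g2) / 2))\<^sup>2 = ((Re g1 - Re g2) / 2)\<^sup>2 + ((Im g1 - Im g2) / 2)\<^sup>2"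
    unfolding cmod_power2 by simp_all
  show ?thesis
    using bellman_gap_real[OF pos v u Q one, of "Re g1" "Re g2"]
      bellman_gap_real[OF pos v u Q one, of "Im g1" "Im g2"]
    unfolding mid cmod_power2[of g1] cmod_power2[of g2] add by (simp only: add_divide_distrib)
qed

section \<open>Dyadic intervals and Haar functions\<close>

definition dyad :: "int \<Rightarrow> int \<Rightarrow> real set" where
  "dyad j k = {of_int k * 2 powi (- j) ..< (of_int k + 1) * 2 powi (- j)}"

lemma dyadic_iff: "I \<in> dyadic \<longleftrightarrow> (\<exists>j k. I = dyad j k)"
  unfolding dyadic_def dyad_def by auto

lemma dyad_in_dyadic [simp, intro]: "dyad j k \<in> dyadic"
  unfolding dyadic_iff by blast

text \<open>Membership as a condition on an integer part reduces disjointness, nesting and refinement of dyadic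
intervals to integer arithmetic.\<close>

lemma mem_dyad: "x \<in> dyad j k \<longleftrightarrow> \<lfloor>x * 2 powi j\<rfloor> = k"
proof -
  have "(0::real) < 2 powi j" by simp
  then have "of_int k * 2 powi (- j) \<le> x \<longleftrightarrow> of_int k \<le> x * 2 powi j"
    "x < (of_int k + 1) * 2 powi (- j) \<longleftrightarrow> x * 2 powi j < of_int k + 1"
    by (simp_all add: power_int_minus field_simps)
  then show ?thesis by (simp add: dyad_def floor_eq_iff)
qed

lemma dyad_sets [measurable, simp]: "dyad j k \<in> sets lebesgue" "dyad j k \<in> sets borel"
  by (auto simp: dyad_def)

lemma emeasure_dyad: "emeasure lebesgue (dyad j k) = ennreal (2 powi (- j))"
proof -
  have "(of_int k::real) * 2 powi (- j) \<le> (of_int k + 1) * 2 powi (- j)"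
    by (intro mult_right_mono) auto
  then show ?thesis by (simp add: dyad_def algebra_simps)
qed

lemma len_dyad: "len (dyad j k) = 2 powi (- j)"
  by (simp add: measure_def emeasure_dyad)

lemma dyad_disjoint: "k \<noteq> l \<Longrightarrow> dyad j k \<inter> dyad j l = {}"
  by (auto simp: mem_dyad)

lemma dyad_nonempty: "of_int k * 2 powi (- j) \<in> dyad j k"
proof -
  have "(2::real) powi (- j) * 2 powi j = 1" by (simp add: power_int_minus)
  then show ?thesis by (simp add: mem_dyad mult.assoc)
qed

lemma powi_two_eq_iff: "(2::real) powi i = 2 powi j \<longleftrightarrow> i = j"
  using power_int_strict_increasing[of i j "2::real"] power_int_strict_increasing[of j i "2::real"]
  by (cases i j rule: linorder_cases) auto

lemma dyad_eq_iff: "dyad j k = dyad j' k' \<longleftrightarrow> j = j' \<and> k = k'"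
proof
  assume eq: "dyad j k = dyad j' k'"
  have "(2::real) powi (- j) = 2 powi (- j')" using len_dyad[of j k] len_dyad[of j' k'] eq by simp
  then have "j = j'" by (simp add: powi_two_eq_iff)
  moreover have "k = k'" using dyad_disjoint[of k k' j] dyad_nonempty[of k j] eq \<open>j = j'\<close> by auto
  ultimately show "j = j' \<and> k = k'" by simp
qed auto

lemma floor_refine:
  fixes x :: real
  shows "\<lfloor>x * 2 powi (j + int n)\<rfloor> \<in> {a * 2 ^ n ..< b * 2 ^ n} \<longleftrightarrow> \<lfloor>x * 2 powi j\<rfloor> \<in> {a ..< b}"
proof -
  have p: "x * 2 powi (j + int n) = (x * 2 powi j) * 2 ^ n"
    by (simp add: power_int_add)
  have "c * 2 ^ n \<le> \<lfloor>x * 2 powi (j + int n)\<rfloor> \<longleftrightarrow> c \<le> \<lfloor>x * 2 powi j\<rfloor>" for c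
    unfolding le_floor_iff p by simp
  then show ?thesis by (simp add: not_le[symmetric])
qed

lemma dyad_eq_UN: "dyad j k = (\<Union>l\<in>{k * 2 ^ n ..< (k + 1) * 2 ^ n}. dyad (j + int n) l)"
proof (rule set_eqI)
  fix x :: real
  have "\<lfloor>x * 2 powi j\<rfloor> = k \<longleftrightarrow> \<lfloor>x * 2 powi j\<rfloor> \<in> {k ..< k + 1}" by auto
  then show "x \<in> dyad j k \<longleftrightarrow> x \<in> (\<Union>l\<in>{k * 2 ^ n ..< (k + 1) * 2 ^ n}. dyad (j + int n) l)"
    unfolding mem_dyad UN_iff floor_refine[of x j n k "k + 1", symmetric] by blast
qed

lemma dyadic_sub_dyad: "dyadic_sub n (dyad j k) = dyad (j + int n) ` {k * 2 ^ n ..< (k + 1) * 2 ^ n}"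
proof (intro equalityI subsetI)
  fix I assume "I \<in> dyadic_sub n (dyad j k)"
  then obtain i l where I: "I = dyad i l" and sub: "dyad i l \<subseteq> dyad j k"
    and eq: "2 powi (- i) = (1 / 2) ^ n * (2::real) powi (- j)"
    unfolding dyadic_sub_def dyadic_iff by (auto simp: len_dyad)
  have "(2::real) powi (- i) = 2 powi (- (j + int n))"
    unfolding eq by (simp add: power_int_add power_int_minus power_int_diff field_simps)
  then have i: "i = j + int n"
    by (simp add: powi_two_eq_iff)
  define x :: real where "x = of_int l * 2 powi (- i)"
  have "x \<in> dyad i l" unfolding x_def by (rule dyad_nonempty)
  then have "\<lfloor>x * 2 powi (j + int n)\<rfloor> = l" "\<lfloor>x * 2 powi j\<rfloor> = k"
    using sub i by (auto simp: mem_dyad)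
  then have "l \<in> {k * 2 ^ n ..< (k + 1) * 2 ^ n}" using floor_refine[of x j n k "k + 1"] by auto
  then show "I \<in> dyad (j + int n) ` {k * 2 ^ n ..< (k + 1) * 2 ^ n}" using I i by auto
next
  fix I assume "I \<in> dyad (j + int n) ` {k * 2 ^ n ..< (k + 1) * 2 ^ n}"
  then obtain l where l: "l \<in> {k * 2 ^ n ..< (k + 1) * 2 ^ n}" and I: "I = dyad (j + int n) l" by auto
  have "I \<subseteq> dyad j k" unfolding I dyad_eq_UN[of j k n] using l by blast
  then show "I \<in> dyadic_sub n (dyad j k)"
    unfolding dyadic_sub_def I by (simp add: len_dyad power_int_add power_int_minus power_int_diff field_simps)
qed

lemma powi_half: "(2::real) powi (- (j + 1)) = 2 powi (- j) / 2"
proof -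
  have "- (j + 1) = - j + - 1" by simp
  moreover have "(2::real) powi (- j + - 1) = 2 powi (- j) * 2 powi (- 1)" by (rule power_int_add) simp
  ultimately show ?thesis by (simp add: power_int_minus)
qed

lemma len_child: "len (dyad (j + 1) l) = len (dyad j k) / 2"
  unfolding len_dyad by (rule powi_half)

lemma halves_dyad:
  "left_half (dyad j k) = dyad (j + 1) (2 * k)" "right_half (dyad j k) = dyad (j + 1) (2 * k + 1)"
proof -
  have lt: "(of_int k::real) * 2 powi (- j) < (of_int k + 1) * 2 powi (- j)"
    by (intro mult_strict_right_mono) auto
  have I: "Inf (dyad j k) = of_int k * 2 powi (- j)" "Sup (dyad j k) = (of_int k + 1) * 2 powi (- j)"
    unfolding dyad_def using lt by auto
  note h = powi_half[of j]
  show "left_half (dyad j k) = dyad (j + 1) (2 * k)"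
    unfolding left_half_def I unfolding dyad_def h by (simp add: field_simps)
  show "right_half (dyad j k) = dyad (j + 1) (2 * k + 1)"
    unfolding right_half_def I unfolding dyad_def h by (simp add: add_divide_distrib algebra_simps)
qed

lemma dyad_children: "dyad j k = dyad (j + 1) (2 * k) \<union> dyad (j + 1) (2 * k + 1)"
proof -
  have "{k * 2 ^ 1 ..< (k + 1) * 2 ^ 1} = {2 * k, 2 * k + 1}" by auto
  then show ?thesis using dyad_eq_UN[of j k 1] by simp
qed

lemma haar_dyad: "haar (dyad j k) x = complex_of_real (1 / sqrt (len (dyad j k)) *
    (indicator (dyad (j + 1) (2 * k + 1)) x - indicator (dyad (j + 1) (2 * k)) x))"
  by (simp add: haar_def halves_dyad)

lemma haar_measurable [measurable]: "I \<in> dyadic \<Longrightarrow> haar I \<in> borel_measurable lebesgue"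
proof -
  assume "I \<in> dyadic"
  then obtain j k where I: "I = dyad j k" unfolding dyadic_iff by blast
  show ?thesis unfolding I haar_dyad[abs_def] by measurable
qed

lemma norm_haar_square: 
  assumes "I \<in> dyadic" shows "(cmod (haar I x))\<^sup>2 = indicator I x / len I"
proof -
  obtain j k where I: "I = dyad j k" using assms dyadic_iff by blast
  have "dyad (j + 1) (2 * k) \<inter> dyad (j + 1) (2 * k + 1) = {}" by (intro dyad_disjoint) simp
  then have "(indicator (dyad (j + 1) (2 * k + 1)) x - indicator (dyad (j + 1) (2 * k)) x :: real)\<^sup>2
      = indicator (dyad j k) x"
    unfolding dyad_children[of j k] by (auto simp: indicator_def split: if_splits)
  then show ?thesis unfolding I haar_dyad norm_of_real power2_abs power_mult_distrib
    by (simp add: power_divide)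
qed

lemma cnj_haar [simp]: "cnj (haar I x) = haar I x"
  by (simp add: haar_def)

lemma dyadic_sub_cover:
  assumes "L \<in> dyadic"
  shows "finite (dyadic_sub n L)" "dyadic_sub n L \<subseteq> dyadic" "disjoint (dyadic_sub n L)"
    "\<Union>(dyadic_sub n L) = L"
proof -
  obtain j k where L: "L = dyad j k" using assms dyadic_iff by blast
  show "finite (dyadic_sub n L)" "dyadic_sub n L \<subseteq> dyadic"
    unfolding L dyadic_sub_dyad by auto
  show "disjoint (dyadic_sub n L)"
    unfolding L dyadic_sub_dyad disjoint_def by (auto simp: mem_dyad)
  show "\<Union>(dyadic_sub n L) = L"
    unfolding L dyadic_sub_dyad using dyad_eq_UN[of j k n] by simp
qed

lemma dyadic_sub_inj:
  assumes "L \<in> dyadic" "L' \<in> dyadic" "I \<in> dyadic_sub n L" "I \<in> dyadic_sub n L'"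
  shows "L = L'"
proof -
  obtain j k where L1: "L = dyad j k" using assms(1) dyadic_iff by blast
  obtain j' k' where L2: "L' = dyad j' k'" using assms(2) dyadic_iff by blast
  note L = L1 L2
  obtain l where I: "I = dyad (j + int n) l" using assms(3) unfolding L dyadic_sub_dyad by blast
  obtain l' where I': "I = dyad (j' + int n) l'" using assms(4) unfolding L dyadic_sub_dyad by blast
  have j: "j = j'" using I I' by (simp add: dyad_eq_iff)
  have "I \<subseteq> L" "I \<subseteq> L'" using assms unfolding dyadic_sub_def by auto
  then have "dyad j k \<inter> dyad j' k' \<noteq> {}" using dyad_nonempty[of l "j + int n"] unfolding L I by blast
  then show ?thesis using j dyad_disjoint[of k k' j] unfolding L by auto
qed

lemma len_dyadic_pos: "L \<in> dyadic \<Longrightarrow> 0 < len L"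
  unfolding dyadic_iff by (auto simp: len_dyad)

lemma emeasure_dyadic_finite: "L \<in> dyadic \<Longrightarrow> emeasure lebesgue L \<noteq> \<infinity>"
  by (auto simp only: dyadic_iff emeasure_dyad ennreal_neq_top infinity_ennreal_def)

lemma len_dyadic_sub: "I \<in> dyadic_sub n L \<Longrightarrow> len I = (1 / 2) ^ n * len L"
  unfolding dyadic_sub_def by auto

lemma dyadic_sets [measurable, simp]: "I \<in> dyadic \<Longrightarrow> I \<in> sets lebesgue"
  unfolding dyadic_iff by auto

lemma dyadic_subset_compact: "I \<in> dyadic \<Longrightarrow> \<exists>K. compact K \<and> I \<subseteq> K"
proof -
  assume "I \<in> dyadic"
  then obtain j k where I: "I = dyad j k" unfolding dyadic_iff by blast
  have "dyad j k \<subseteq> {of_int k * 2 powi (- j) .. (of_int k + 1) * 2 powi (- j)}"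
    unfolding dyad_def by auto
  then show ?thesis unfolding I by blast
qed

section \<open>Summation over dyadic generations\<close>

lemma sum_split_parity:
  fixes f :: "int \<Rightarrow> real"
  shows "(\<Sum>l\<in>{2 * a ..< 2 * b}. f l) = (\<Sum>k\<in>{a ..< b}. f (2 * k) + f (2 * k + 1))"
proof -
  have eq: "{2 * a ..< 2 * b} = (\<lambda>k. 2 * k) ` {a ..< b} \<union> (\<lambda>k. 2 * k + 1) ` {a ..< b}"
  proof (intro equalityI subsetI)
    fix l assume "l \<in> {2 * a ..< 2 * b}"
    moreover have "l = 2 * (l div 2) \<or> l = 2 * (l div 2) + 1" by presburger
    moreover have "l \<in> {2 * a ..< 2 * b} \<Longrightarrow> l div 2 \<in> {a ..< b}" by auto
    ultimately show "l \<in> (\<lambda>k. 2 * k) ` {a ..< b} \<union> (\<lambda>k. 2 * k + 1) ` {a ..< b}" by blast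
  qed auto
  have disj: "(\<lambda>k. 2 * k) ` {a ..< b} \<inter> (\<lambda>k. 2 * k + 1) ` {a ..< b} = {}"
    by auto presburger
  show ?thesis
    unfolding eq sum.distrib
    by (subst sum.union_disjoint) (auto simp: disj sum.reindex inj_on_def)
qed

text \<open>The function \<open>\<beta>\<close> gains \<open>e\<close> at every halving and is bounded by the additive set function \<open>E\<close>, so the
sum of \<open>\<beta>\<close> over a block of intervals plus the total gain below it cannot exceed the value of \<open>E\<close> on the block.\<close>

lemma telescope_generations:
  fixes \<beta> e E :: "int \<Rightarrow> int \<Rightarrow> real"
  assumes step: "\<And>j k. \<beta> j k + e j k \<le> \<beta> (j + 1) (2 * k) + \<beta> (j + 1) (2 * k + 1)"
    and bound: "\<And>j k. \<beta> j k \<le> E j k"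
    and add: "\<And>j k. E j k = E (j + 1) (2 * k) + E (j + 1) (2 * k + 1)"
  shows "(\<Sum>k\<in>{a ..< b}. \<beta> j k) + (\<Sum>i<n. \<Sum>k\<in>{a * 2 ^ i ..< b * 2 ^ i}. e (j + int i) k)
           \<le> (\<Sum>k\<in>{a ..< b}. E j k)"
proof (induction n arbitrary: j a b)
  case 0
  show ?case using bound by (simp add: sum_mono)
next
  case (Suc n)
  have "(\<Sum>k\<in>{a ..< b}. \<beta> j k) + (\<Sum>i<Suc n. \<Sum>k\<in>{a * 2 ^ i ..< b * 2 ^ i}. e (j + int i) k)
      = (\<Sum>k\<in>{a ..< b}. \<beta> j k + e j k)
        + (\<Sum>i<n. \<Sum>k\<in>{2 * a * 2 ^ i ..< 2 * b * 2 ^ i}. e (j + 1 + int i) k)"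
    by (simp add: sum.lessThan_Suc_shift sum.distrib algebra_simps del: sum.lessThan_Suc)
  also have "(\<Sum>k\<in>{a ..< b}. \<beta> j k + e j k)
      \<le> (\<Sum>k\<in>{a ..< b}. \<beta> (j + 1) (2 * k) + \<beta> (j + 1) (2 * k + 1))"
    by (intro sum_mono step)
  also have "\<dots> = (\<Sum>l\<in>{2 * a ..< 2 * b}. \<beta> (j + 1) l)" by (rule sum_split_parity[symmetric])
  also have "(\<Sum>l\<in>{2 * a ..< 2 * b}. \<beta> (j + 1) l)
        + (\<Sum>i<n. \<Sum>k\<in>{2 * a * 2 ^ i ..< 2 * b * 2 ^ i}. e (j + 1 + int i) k)
      \<le> (\<Sum>l\<in>{2 * a ..< 2 * b}. E (j + 1) l)"
    by (rule Suc.IH)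
  also have "\<dots> = (\<Sum>k\<in>{a ..< b}. E j k)" by (simp add: sum_split_parity add[symmetric])
  finally show ?case by simp
qed

text \<open>A finite set of dyadic intervals is contained in finitely many consecutive generations below a finite
block of intervals of one large size, which is allowed to straddle the origin.\<close>

lemma finite_dyadic_sum_le:
  fixes \<beta> e E :: "int \<Rightarrow> int \<Rightarrow> real"
  assumes step: "\<And>j k. \<beta> j k + e j k \<le> \<beta> (j + 1) (2 * k) + \<beta> (j + 1) (2 * k + 1)"
    and bound: "\<And>j k. \<beta> j k \<le> E j k"
    and add: "\<And>j k. E j k = E (j + 1) (2 * k) + E (j + 1) (2 * k + 1)"
    and \<beta>0: "\<And>j k. 0 \<le> \<beta> j k" and e0: "\<And>j k. 0 \<le> e j k"
    and T: "\<And>j a b. (\<Sum>k\<in>{a ..< b}. E j k) \<le> T"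
    and A: "finite A"
  shows "(\<Sum>(j, k)\<in>A. e j k) \<le> T"
proof -
  define N where "N = Max (insert 0 ((\<lambda>p. max \<bar>fst p\<bar> \<bar>snd p\<bar>) ` A))"
  have N: "max \<bar>fst p\<bar> \<bar>snd p\<bar> \<le> N" if "p \<in> A" for p
    unfolding N_def using A that by (intro Max_ge) auto
  define n where "n = nat (2 * N + 1)"
  define S where "S = (SIGMA i:{..<n}. {- (N + 1) * 2 ^ i ..< (N + 1) * 2 ^ i})"
  define h where "h = (\<lambda>(i, k). (- N + int i, k :: int))"
  have finS: "finite S" unfolding S_def by auto
  have inj: "inj_on h S" by (auto simp: h_def inj_on_def)
  have sub: "A \<subseteq> h ` S"
  proof
    fix p assume p: "p \<in> A"
    obtain j k where jk: "p = (j, k)" by (cases p)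
    have b: "\<bar>j\<bar> \<le> N" "\<bar>k\<bar> \<le> N" using N[OF p] jk by auto
    define i where "i = nat (j + N)"
    have i: "i < n" "j = - N + int i" using b by (auto simp: i_def n_def)
    \<comment> \<open>In units of the smaller intervals the block only becomes longer.\<close>
    have "(N + 1) * 1 \<le> (N + 1) * 2 ^ i" using b by (intro mult_left_mono) auto
    moreover have "- (N + 1) * 2 ^ i = - ((N + 1) * 2 ^ i)" by (rule mult_minus_left)
    ultimately have "k \<in> {- (N + 1) * 2 ^ i ..< (N + 1) * 2 ^ i}" using b by auto
    then have "(i, k) \<in> S" using i by (auto simp: S_def)
    moreover have "p = h (i, k)" using i jk by (simp add: h_def)
    ultimately show "p \<in> h ` S" by blast
  qed
  have "(\<Sum>(j, k)\<in>A. e j k) \<le> (\<Sum>(j, k)\<in>h ` S. e j k)"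
    using sub finS e0 by (intro sum_mono2) auto
  also have "\<dots> = (\<Sum>(i, k)\<in>S. e (- N + int i) k)"
    by (subst sum.reindex[OF inj]) (auto simp: h_def case_prod_unfold intro: sum.cong)
  also have "\<dots> = (\<Sum>i<n. \<Sum>k\<in>{- (N + 1) * 2 ^ i ..< (N + 1) * 2 ^ i}. e (- N + int i) k)"
    unfolding S_def by (subst sum.Sigma) auto
  also have "\<dots> \<le> (\<Sum>k\<in>{- (N + 1) ..< N + 1}. E (- N) k)"
    using telescope_generations[where \<beta> = \<beta> and e = e and E = E and a = "- (N + 1)" and b = "N + 1"
          and j = "- N" and n = n, OF step bound add]
      sum_nonneg[of "{- (N + 1) ..< N + 1}" "\<beta> (- N)"] \<beta>0
    by auto
  also have "\<dots> \<le> T" by (rule T)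
  finally show ?thesis .
qed

section \<open>Weights and their means\<close>

text \<open>Integrating \<open>2 |g| \<le> l |g|\<^sup>2 / v + v / l\<close> and choosing \<open>l\<close> optimally gives the inequality, and also the
integrability of \<open>g\<close>. Points with \<open>v = 0\<close> are admitted so that the functions may be cut off by an
indicator.\<close>

lemma integral_Cauchy_Schwarz:
  fixes g :: "'a \<Rightarrow> complex" and v :: "'a \<Rightarrow> real"
  assumes [measurable]: "g \<in> borel_measurable M"
    and v: "integrable M v" and gv: "integrable M (\<lambda>x. (cmod (g x))\<^sup>2 / v x)"
    and pos: "AE x in M. 0 \<le> v x \<and> (v x = 0 \<longrightarrow> g x = 0)"
  shows "integrable M g"
    and "(cmod (integral\<^sup>L M g))\<^sup>2 \<le> integral\<^sup>L M (\<lambda>x. (cmod (g x))\<^sup>2 / v x) * integral\<^sup>L M v"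
proof -
  let ?X = "integral\<^sup>L M (\<lambda>x. (cmod (g x))\<^sup>2 / v x)" and ?V = "integral\<^sup>L M v"
  have young: "AE x in M. cmod (g x) \<le> (l * ((cmod (g x))\<^sup>2 / v x) + v x / l) / 2" if l: "l > 0" for l :: real
    using pos
  proof eventually_elim
    case (elim x)
    show ?case
    proof (cases "v x = 0")
      case False
      then have v0: "v x > 0" using elim by auto
      have "0 \<le> (l * cmod (g x) - v x)\<^sup>2 / (l * v x)" using l v0 by simp
      also have "\<dots> = l * ((cmod (g x))\<^sup>2 / v x) + v x / l - 2 * cmod (g x)"
        using l v0 by (simp add: power2_eq_square field_simps)
      finally show ?thesis by simp
    qed (use elim in auto)
  qed
  show int: "integrable M g"
  proof (rule Bochner_Integration.integrable_bound)
    show "integrable M (\<lambda>x. (1 * ((cmod (g x))\<^sup>2 / v x) + v x / 1) / 2)"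
      by (intro integrable_divide_zero Bochner_Integration.integrable_add integrable_mult_right v gv)
    show "AE x in M. norm (g x) \<le> norm ((1 * ((cmod (g x))\<^sup>2 / v x) + v x / 1) / 2)"
      using young[OF zero_less_one] by eventually_elim (metis abs_ge_self order_trans real_norm_def)
  qed measurable
  define G where "G = integral\<^sup>L M (\<lambda>x. cmod (g x))"
  have G: "cmod (integral\<^sup>L M g) \<le> G" unfolding G_def by (rule integral_norm_bound)
  have X0: "?X \<ge> 0" using pos by (intro integral_nonneg_AE) auto
  have V0: "?V \<ge> 0" using pos by (intro integral_nonneg_AE) auto
  have opt: "G \<le> (l * ?X + ?V / l) / 2" if l: "l > 0" for l
  proof -
    have "G \<le> integral\<^sup>L M (\<lambda>x. (l * ((cmod (g x))\<^sup>2 / v x) + v x / l) / 2)"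
      unfolding G_def using int young[OF l] v gv
      by (intro integral_mono_AE integrable_norm integrable_divide_zero Bochner_Integration.integrable_add
          integrable_mult_right) auto
    also have "\<dots> = (l * ?X + ?V / l) / 2"
      using v gv by (simp del: times_divide_eq_right)
    finally show ?thesis .
  qed
  have "G\<^sup>2 \<le> ?X * ?V"
  proof (cases "G > 0")
    case G0: True
    show ?thesis
    proof (cases "?V > 0")
      case True
      have "2 * G \<le> ?V / G * ?X + G" using opt[of "?V / G"] True G0 by (simp add: field_simps)
      then have "G \<le> ?V / G * ?X" by simp
      then show ?thesis using G0 by (simp add: power2_eq_square field_simps)
    next
      case False
      then have V: "?V = 0" using V0 by simp
      \<comment> \<open>The optimal \<open>l\<close> is infinite here; any positive \<open>l\<close> with \<open>l X \<le> G\<close> contradicts \<open>G > 0\<close>.\<close>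
      define l where "l = G / (?X + 1)"
      have "l > 0" unfolding l_def using G0 X0 by simp
      then have "2 * G \<le> l * ?X" using opt[of l] unfolding V by simp
      also have "\<dots> \<le> G" unfolding l_def using G0 X0 by (simp add: field_simps)
      finally show ?thesis using G0 by simp
    qed
  next
    case False
    moreover have "G \<ge> 0" unfolding G_def by simp
    ultimately have "G = 0" by simp
    then show ?thesis using X0 V0 by simp
  qed
  moreover have "(cmod (integral\<^sup>L M g))\<^sup>2 \<le> G\<^sup>2" using G by (intro power_mono) auto
  ultimately show "(cmod (integral\<^sup>L M g))\<^sup>2 \<le> ?X * ?V" by linarith
qed

lemma set_integral_Cauchy_Schwarz:
  fixes g :: "'a \<Rightarrow> complex" and v :: "'a \<Rightarrow> real"
  assumes S: "S \<in> sets M" and g: "g \<in> borel_measurable M"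
    and v: "set_integrable M S v" and gv: "set_integrable M S (\<lambda>x. (cmod (g x))\<^sup>2 / v x)"
    and pos: "AE x in M. 0 < v x"
  shows "set_integrable M S g"
    and "(cmod (LINT x:S|M. g x))\<^sup>2 \<le> (LINT x:S|M. (cmod (g x))\<^sup>2 / v x) * (LINT x:S|M. v x)"
proof -
  have m: "(\<lambda>x. indicat_real S x *\<^sub>R g x) \<in> borel_measurable M" using S g by measurable
  have eq: "(cmod (indicat_real S x *\<^sub>R g x))\<^sup>2 / (indicat_real S x *\<^sub>R v x)
      = indicat_real S x *\<^sub>R ((cmod (g x))\<^sup>2 / v x)" for x
    by (simp add: indicator_def)
  have p: "AE x in M. 0 \<le> indicat_real S x *\<^sub>R v x \<and> (indicat_real S x *\<^sub>R v x = 0 \<longrightarrow> indicat_real S x *\<^sub>R g x = 0)"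
    using pos by eventually_elim (auto simp: indicator_def)
  note CS = integral_Cauchy_Schwarz[OF m v[unfolded set_integrable_def] _ p, unfolded eq,
      OF gv[unfolded set_integrable_def]]
  show "set_integrable M S g" using CS(1) by (simp add: set_integrable_def)
  show "(cmod (LINT x:S|M. g x))\<^sup>2 \<le> (LINT x:S|M. (cmod (g x))\<^sup>2 / v x) * (LINT x:S|M. v x)"
    using CS(2) by (simp add: set_lebesgue_integral_def)
qed

lemma weight_measurable: 
  assumes "weight w" shows "w \<in> borel_measurable lebesgue"
proof (rule borel_measurable_LIMSEQ_real)
  fix x
  obtain N :: nat where N: "\<bar>x\<bar> \<le> real N" using real_arch_simple by blast
  have "\<forall>\<^sub>F n in sequentially. indicat_real {- real n .. real n} x *\<^sub>R w x = w x"
    using eventually_ge_at_top[of N] by eventually_elim (use N in \<open>auto simp: indicator_def\<close>)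
  then show "(\<lambda>n. indicat_real {- real n .. real n} x *\<^sub>R w x) \<longlonglongrightarrow> w x"
    by (rule tendsto_eventually)
next
  fix n :: nat
  have "set_integrable lebesgue {- real n .. real n} w" using assms unfolding weight_def by blast
  then show "(\<lambda>x. indicat_real {- real n .. real n} x *\<^sub>R w x) \<in> borel_measurable lebesgue"
    unfolding set_integrable_def by (rule borel_measurable_integrable)
qed

lemma weight_set_integrable:
  assumes "weight w" "I \<in> dyadic" shows "set_integrable lebesgue I w"
proof -
  obtain K where K: "compact K" "I \<subseteq> K" using dyadic_subset_compact[OF assms(2)] by blast
  then have "set_integrable lebesgue K w" using assms unfolding weight_def by blast
  then show ?thesis by (rule set_integrable_subset) (use assms K in auto)
qed

lemma mean_pos:
  assumes I: "I \<in> dyadic" and f: "set_integrable lebesgue I f" and pos: "AE x in lebesgue. 0 < f x"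
  shows "0 < mean I f"
proof -
  let ?h = "\<lambda>x. indicat_real I x *\<^sub>R f x"
  have nn: "AE x in lebesgue. 0 \<le> ?h x" using pos by eventually_elim (auto simp: indicator_def)
  have int: "integrable lebesgue ?h" using f by (simp add: set_integrable_def)
  have "integral\<^sup>L lebesgue ?h \<noteq> 0"
  proof
    assume "integral\<^sup>L lebesgue ?h = 0"
    then have "AE x in lebesgue. ?h x = 0" using integral_nonneg_eq_0_iff_AE[OF int nn] by simp
    then have "AE x in lebesgue. x \<notin> I" using pos by eventually_elim (auto simp: indicator_def)
    then have "emeasure lebesgue I = 0" using I by (subst (asm) AE_iff_measurable[OF _ refl]) auto
    then show False using len_dyadic_pos[OF I] by (simp add: measure_def)
  qed
  then have "0 < integral\<^sup>L lebesgue ?h" using integral_nonneg_AE[OF nn] by simp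
  then show ?thesis unfolding mean_def set_lebesgue_integral_def using len_dyadic_pos[OF I] by simp
qed

lemma emean_eq_mean:
  assumes I: "I \<in> dyadic" and f: "set_integrable lebesgue I f" and nn: "AE x in lebesgue. 0 \<le> f x"
  shows "emean I f = ennreal (mean I f)"
proof -
  let ?h = "\<lambda>x. indicat_real I x *\<^sub>R f x"
  have nn': "AE x in lebesgue. 0 \<le> ?h x" using nn by eventually_elim (auto simp: indicator_def)
  have "(\<integral>\<^sup>+ x\<in>I. ennreal (f x) \<partial>lebesgue) = (\<integral>\<^sup>+ x. ennreal (?h x) \<partial>lebesgue)"
    by (intro nn_integral_cong) (auto simp: indicator_def)
  also have "\<dots> = ennreal (integral\<^sup>L lebesgue ?h)"
    using f nn' by (intro nn_integral_eq_integral) (auto simp: set_integrable_def)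
  finally show ?thesis
    unfolding emean_def mean_def set_lebesgue_integral_def
    using integral_nonneg_AE[OF nn'] len_dyadic_pos[OF I] by (simp add: divide_ennreal)
qed

lemma emean_finite_imp_integrable:
  assumes I: "I \<in> dyadic" and f: "f \<in> borel_measurable lebesgue" and nn: "AE x in lebesgue. 0 \<le> f x"
    and fin: "emean I f < \<infinity>"
  shows "set_integrable lebesgue I f"
  unfolding set_integrable_def
proof (rule integrableI_bounded)
  show "(\<lambda>x. indicat_real I x *\<^sub>R f x) \<in> borel_measurable lebesgue" using I f by measurable
  have "(\<integral>\<^sup>+ x. ennreal (norm (indicat_real I x *\<^sub>R f x)) \<partial>lebesgue) = (\<integral>\<^sup>+ x\<in>I. ennreal (f x) \<partial>lebesgue)"
    by (intro nn_integral_cong_AE, use nn in eventually_elim) (auto simp: indicator_def)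
  also have "\<dots> < \<infinity>"
    using fin unfolding emean_def by (auto simp: ennreal_divide_eq_top_iff less_top[symmetric])
  finally show "(\<integral>\<^sup>+ x. ennreal (norm (indicat_real I x *\<^sub>R f x)) \<partial>lebesgue) < \<infinity>" .
qed

text \<open>A finite product of the two means, the first of which is positive, makes \<open>1 / v\<close> locally integrable.
That the product is at least \<open>1\<close> is Cauchy-Schwarz for the function \<open>1\<close>.\<close>

lemma A2_weight:
  assumes v: "weight v" and A: "A2_const v \<le> ennreal Q" and I: "I \<in> dyadic"
  shows "set_integrable lebesgue I v" "set_integrable lebesgue I (\<lambda>x. inverse (v x))"
    "0 < mean I v" "0 < mean I (\<lambda>x. inverse (v x))"
    "1 \<le> mean I v * mean I (\<lambda>x. inverse (v x))" "mean I v * mean I (\<lambda>x. inverse (v x)) \<le> Q"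
proof -
  have [measurable]: "v \<in> borel_measurable lebesgue" using v by (rule weight_measurable)
  have pos: "AE x in lebesgue. 0 < v x" using v by (simp add: weight_def)
  have ipos: "AE x in lebesgue. 0 < inverse (v x)" using pos by eventually_elim simp
  show iv: "set_integrable lebesgue I v" using v I by (rule weight_set_integrable)
  show m: "0 < mean I v" using I iv pos by (rule mean_pos)
  have ev: "emean I v = ennreal (mean I v)"
    using I iv pos by (intro emean_eq_mean) (auto elim: eventually_mono)
  have le: "emean I v * emean I (\<lambda>x. inverse (v x)) \<le> ennreal Q"
    using A I unfolding A2_const_def by (meson SUP_upper order_trans)
  have "emean I (\<lambda>x. inverse (v x)) < \<infinity>"
  proof (rule ccontr)
    assume "\<not> emean I (\<lambda>x. inverse (v x)) < \<infinity>"
    then have "emean I (\<lambda>x. inverse (v x)) = \<infinity>" by (simp add: less_top[symmetric])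
    then show False using le m ev by (simp add: ennreal_mult_top top_unique)
  qed
  then show ii: "set_integrable lebesgue I (\<lambda>x. inverse (v x))"
    using I ipos by (intro emean_finite_imp_integrable) (auto elim: eventually_mono)
  show mi: "0 < mean I (\<lambda>x. inverse (v x))" using I ii ipos by (rule mean_pos)
  have ei: "emean I (\<lambda>x. inverse (v x)) = ennreal (mean I (\<lambda>x. inverse (v x)))"
    using I ii ipos by (intro emean_eq_mean) (auto elim: eventually_mono)
  have "ennreal (mean I v * mean I (\<lambda>x. inverse (v x))) \<le> ennreal Q"
    using le m mi unfolding ev ei by (simp add: ennreal_mult)
  moreover have "0 < mean I v * mean I (\<lambda>x. inverse (v x))" using m mi by simp
  ultimately show "mean I v * mean I (\<lambda>x. inverse (v x)) \<le> Q"
    by (metis ennreal_le_iff2 not_less)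
  have "(cmod (LINT x:I|lebesgue. 1))\<^sup>2 \<le> (LINT x:I|lebesgue. (cmod 1)\<^sup>2 / v x) * (LINT x:I|lebesgue. v x)"
    using I iv ii pos by (intro set_integral_Cauchy_Schwarz) (auto simp: inverse_eq_divide)
  moreover have "(LINT x:I|lebesgue. (1::complex)) = complex_of_real (len I)"
    using I emeasure_dyadic_finite[OF I] by (subst set_integral_const) (auto simp: scaleR_conv_of_real)
  ultimately have "(len I)\<^sup>2 \<le> (LINT x:I|lebesgue. inverse (v x)) * (LINT x:I|lebesgue. v x)"
    by (simp add: inverse_eq_divide)
  then show "1 \<le> mean I v * mean I (\<lambda>x. inverse (v x))"
    using len_dyadic_pos[OF I] unfolding mean_def by (simp add: field_simps power2_eq_square)
qed

section \<open>The weighted square function\<close>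

lemma set_integrable_dyad_children:
  fixes f :: "real \<Rightarrow> 'a::{banach, second_countable_topology}"
  assumes f: "set_integrable lebesgue (dyad j k) f"
  shows "set_integrable lebesgue (dyad (j + 1) (2 * k)) f"
    "set_integrable lebesgue (dyad (j + 1) (2 * k + 1)) f"
    "(LINT x:dyad j k|lebesgue. f x)
       = (LINT x:dyad (j + 1) (2 * k)|lebesgue. f x) + (LINT x:dyad (j + 1) (2 * k + 1)|lebesgue. f x)"
proof -
  show 1: "set_integrable lebesgue (dyad (j + 1) (2 * k)) f"
    by (rule set_integrable_subset[OF f]) (simp, use dyad_children[of j k] in blast)
  show 2: "set_integrable lebesgue (dyad (j + 1) (2 * k + 1)) f"
    by (rule set_integrable_subset[OF f]) (simp, use dyad_children[of j k] in blast)
  have "dyad (j + 1) (2 * k) \<inter> dyad (j + 1) (2 * k + 1) = {}" by (intro dyad_disjoint) simp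
  then show "(LINT x:dyad j k|lebesgue. f x)
       = (LINT x:dyad (j + 1) (2 * k)|lebesgue. f x) + (LINT x:dyad (j + 1) (2 * k + 1)|lebesgue. f x)"
    using 1 2 unfolding dyad_children[of j k] by (rule set_integral_Un)
qed

lemma mean_children:
  assumes "set_integrable lebesgue (dyad j k) f"
  shows "mean (dyad j k) f = (mean (dyad (j + 1) (2 * k)) f + mean (dyad (j + 1) (2 * k + 1)) f) / 2"
proof -
  have "1 / l * (a + b) = (1 / (l / 2) * a + 1 / (l / 2) * b) / 2" for l a b :: real
    by (simp add: divide_simps)
  then show ?thesis
    unfolding mean_def len_child[of j _ k]
    by (subst set_integrable_dyad_children(3)[OF assms])
qed

text \<open>In terms of means the right-hand side is the square root of the length times half of the difference of
the means over the two children, which is the increment in \<open>bellman_gap\<close>.\<close>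

lemma L2_inner_haar_dyad:
  assumes g: "set_integrable lebesgue (dyad j k) g"
  shows "L2_inner g (haar (dyad j k)) = complex_of_real (1 / sqrt (len (dyad j k))) *
    ((LINT x:dyad (j + 1) (2 * k + 1)|lebesgue. g x) - (LINT x:dyad (j + 1) (2 * k)|lebesgue. g x))"
proof -
  have "g x * cnj (haar (dyad j k) x) = complex_of_real (1 / sqrt (len (dyad j k))) *
      (indicat_real (dyad (j + 1) (2 * k + 1)) x *\<^sub>R g x - indicat_real (dyad (j + 1) (2 * k)) x *\<^sub>R g x)" for x
    by (simp add: haar_dyad scaleR_conv_of_real algebra_simps)
  then show ?thesis
    using set_integrable_dyad_children(1,2)[OF g]
    unfolding L2_inner_def set_lebesgue_integral_def set_integrable_def by simp
qed

lemma sum_set_integral_le: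
  fixes f :: "'a \<Rightarrow> real"
  assumes f: "integrable M f" and nn: "AE x in M. 0 \<le> f x"
    and S: "finite S" "\<And>i. i \<in> S \<Longrightarrow> A i \<in> sets M" "disjoint_family_on A S"
  shows "(\<Sum>i\<in>S. LINT x:A i|M. f x) \<le> integral\<^sup>L M f"
proof -
  have int: "integrable M (\<lambda>x. indicat_real (A i) x *\<^sub>R f x)" if "i \<in> S" for i
    using f S(2)[OF that] by (simp add: integrable_real_mult_indicator mult.commute)
  have "(\<Sum>i\<in>S. LINT x:A i|M. f x) = (LINT x|M. (\<Sum>i\<in>S. indicat_real (A i) x *\<^sub>R f x))"
    unfolding set_lebesgue_integral_def using int by (subst Bochner_Integration.integral_sum) auto
  also have "\<dots> \<le> integral\<^sup>L M f"
  proof (rule integral_mono_AE)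
    show "AE x in M. (\<Sum>i\<in>S. indicat_real (A i) x *\<^sub>R f x) \<le> f x"
      using nn
    proof eventually_elim
      case (elim x)
      have "(\<Sum>i\<in>S. indicat_real (A i) x) = indicat_real (\<Union>i\<in>S. A i) x"
        using S by (simp add: indicator_UN_disjoint)
      then have "(\<Sum>i\<in>S. indicat_real (A i) x *\<^sub>R f x) = indicat_real (\<Union>i\<in>S. A i) x * f x"
        by (simp add: sum_distrib_right[symmetric])
      also have "\<dots> \<le> 1 * f x" using elim by (intro mult_right_mono) (auto simp: indicator_def)
      finally show ?case by simp
    qed
  qed (use int f in auto)
  finally show ?thesis .
qed

text \<open>The Bellman function of the means over an interval, times its length, is the quantity that gains at
least the contribution of the interval when the interval is halved. By Cauchy-Schwarz it is at most \<open>393 Q\<close>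
times the integral of \<open>|g|\<^sup>2 / v\<close> over the interval, which is additive, so
\<open>finite_dyadic_sum_le\<close> applies.\<close>

lemma square_function_indexed:
  assumes v: "weight v" and A2: "A2_const v \<le> ennreal Q" and g[measurable]: "g \<in> borel_measurable lebesgue"
    and gv: "integrable lebesgue (\<lambda>x. (cmod (g x))\<^sup>2 / v x)" and A: "finite A"
  shows "(\<Sum>(j, k)\<in>A. (cmod (L2_inner g (haar (dyad j k))))\<^sup>2 / mean (dyad j k) v)
    \<le> 786 * Q * (LINT x|lebesgue. (cmod (g x))\<^sup>2 / v x)"
proof -
  let ?X = "LINT x|lebesgue. (cmod (g x))\<^sup>2 / v x"
  define \<gamma> where "\<gamma> j k = (LINT x:dyad j k|lebesgue. g x) / complex_of_real (len (dyad j k))" for j k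
  define V where "V j k = mean (dyad j k) v" for j k
  define U where "U j k = mean (dyad j k) (\<lambda>x. inverse (v x))" for j k
  define E where "E j k = 393 * Q * (LINT x:dyad j k|lebesgue. (cmod (g x))\<^sup>2 / v x)" for j k
  define e where "e j k = (cmod (L2_inner g (haar (dyad j k))))\<^sup>2 / V j k" for j k
  define \<beta> where "\<beta> j k = len (dyad j k) * bellman Q ((cmod (\<gamma> j k))\<^sup>2) (V j k) (U j k)" for j k
  have pos: "AE x in lebesgue. 0 < v x" using v by (simp add: weight_def)
  have nn: "AE x in lebesgue. 0 \<le> (cmod (g x))\<^sup>2 / v x" using pos by eventually_elim simp
  note w = A2_weight[OF v A2 dyad_in_dyadic]
  have VU: "0 < V j k" "0 < U j k" "1 \<le> V j k * U j k" "V j k * U j k \<le> Q" for j k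
    unfolding V_def U_def using w by auto
  have Q1: "1 \<le> Q" using VU(3,4) order_trans by blast
  have igv: "set_integrable lebesgue (dyad j k) (\<lambda>x. (cmod (g x))\<^sup>2 / v x)" for j k
    unfolding set_integrable_def using gv by (intro integrable_mult_indicator) auto
  note CS = set_integral_Cauchy_Schwarz[OF dyad_sets(1) g w(1) igv pos]
  have len0: "0 < len (dyad j k)" for j k by (intro len_dyadic_pos) simp
  have step: "\<beta> j k + e j k / 2 \<le> \<beta> (j + 1) (2 * k) + \<beta> (j + 1) (2 * k + 1)" for j k
  proof -
    let ?l = "len (dyad j k)"
    let ?g1 = "\<gamma> (j + 1) (2 * k)" and ?g2 = "\<gamma> (j + 1) (2 * k + 1)"
    have V: "V j k = (V (j + 1) (2 * k) + V (j + 1) (2 * k + 1)) / 2"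
      and U: "U j k = (U (j + 1) (2 * k) + U (j + 1) (2 * k + 1)) / 2"
      unfolding V_def U_def by (intro mean_children w)+
    have G: "\<gamma> j k = (?g1 + ?g2) / 2"
    proof -
      have "(a + b) / l = (a / (l / 2) + b / (l / 2)) / 2" for l a b :: complex by (simp add: add_divide_distrib)
      then show ?thesis
        unfolding \<gamma>_def set_integrable_dyad_children(3)[OF CS(1)[of j k]] len_child[of j _ k] of_real_divide of_real_numeral .
    qed
    have "L2_inner g (haar (dyad j k)) = complex_of_real (1 / sqrt ?l) *
        (complex_of_real (?l / 2) * (?g2 - ?g1))"
    proof -
      have "b - a = (l / 2) * (b / (l / 2) - a / (l / 2))" if "l \<noteq> 0" for l a b :: complex
        using that by (simp add: diff_divide_distrib[symmetric])
      moreover have "complex_of_real ?l \<noteq> 0" using len0[of j k] by simp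
      ultimately show ?thesis
        unfolding L2_inner_haar_dyad[OF CS(1)[of j k]] \<gamma>_def len_child[of j _ k] of_real_divide of_real_numeral
        by metis
    qed
    then have "cmod (L2_inner g (haar (dyad j k))) = ?l / sqrt ?l * cmod ((?g1 - ?g2) / 2)"
      using len0[of j k] by (simp add: norm_mult norm_divide norm_minus_commute)
    then have "cmod (L2_inner g (haar (dyad j k))) = sqrt ?l * cmod ((?g1 - ?g2) / 2)"
      using len0[of j k] by (simp only: real_div_sqrt less_imp_le)
    then have "(cmod (L2_inner g (haar (dyad j k))))\<^sup>2 = ?l * (cmod ((?g1 - ?g2) / 2))\<^sup>2"
      using len0[of j k] by (simp only: power_mult_distrib real_sqrt_pow2 less_imp_le)
    then have e: "e j k = ?l * ((cmod ((?g1 - ?g2) / 2))\<^sup>2 / V j k)" unfolding e_def by simp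
    have "?l * (bellman Q ((cmod (\<gamma> j k))\<^sup>2) (V j k) (U j k) + (cmod ((?g1 - ?g2) / 2))\<^sup>2 / V j k / 2)
      \<le> ?l * ((bellman Q ((cmod ?g1)\<^sup>2) (V (j + 1) (2 * k)) (U (j + 1) (2 * k))
          + bellman Q ((cmod ?g2)\<^sup>2) (V (j + 1) (2 * k + 1)) (U (j + 1) (2 * k + 1))) / 2)"
      unfolding G by (intro mult_left_mono bellman_gap VU Q1 V U) auto
    then show ?thesis
      unfolding \<beta>_def e len_child[of j _ k] by (simp add: algebra_simps)
  qed
  have bound: "\<beta> j k \<le> E j k" for j k
  proof -
    let ?l = "len (dyad j k)" and ?x = "LINT x:dyad j k|lebesgue. (cmod (g x))\<^sup>2 / v x"
    have "(cmod (LINT x:dyad j k|lebesgue. g x))\<^sup>2 \<le> ?x * (?l * V j k)"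
      using CS(2)[of j k] len0[of j k] by (simp add: V_def mean_def)
    then have "?l * ((cmod (\<gamma> j k))\<^sup>2 / V j k) \<le> ?x"
      using len0[of j k] VU(1)[of j k] unfolding \<gamma>_def norm_divide norm_of_real
      by (simp add: field_simps power2_eq_square)
    then have "393 * Q * (?l * ((cmod (\<gamma> j k))\<^sup>2 / V j k)) \<le> E j k"
      unfolding E_def using Q1 by (intro mult_left_mono) auto
    moreover have "?l * bellman Q ((cmod (\<gamma> j k))\<^sup>2) (V j k) (U j k) \<le> ?l * (393 * Q * ((cmod (\<gamma> j k))\<^sup>2 / V j k))"
      by (intro mult_left_mono bellman_le VU Q1) auto
    ultimately show ?thesis unfolding \<beta>_def by (simp add: algebra_simps)
  qed
  have add: "E j k = E (j + 1) (2 * k) + E (j + 1) (2 * k + 1)" for j k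
    unfolding E_def set_integrable_dyad_children(3)[OF igv[of j k]] by (simp add: algebra_simps)
  have \<beta>0: "0 \<le> \<beta> j k" for j k
    unfolding \<beta>_def by (intro mult_nonneg_nonneg bellman_nonneg VU Q1) auto
  have e0: "0 \<le> e j k / 2" for j k unfolding e_def using VU(1)[of j k] by simp
  have T: "(\<Sum>k\<in>{a ..< b}. E j k) \<le> 393 * Q * ?X" for j a b
  proof -
    have "(\<Sum>k\<in>{a ..< b}. LINT x:dyad j k|lebesgue. (cmod (g x))\<^sup>2 / v x) \<le> ?X"
      using gv nn by (intro sum_set_integral_le) (auto simp: disjoint_family_on_def dyad_disjoint)
    then show ?thesis unfolding E_def sum_distrib_left[symmetric] using Q1 by (intro mult_left_mono) auto
  qed
  have "(\<Sum>(j, k)\<in>A. e j k / 2) \<le> 393 * Q * ?X"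
    by (rule finite_dyadic_sum_le[where \<beta> = \<beta> and E = E and e = "\<lambda>j k. e j k / 2", OF step bound add \<beta>0 e0 T A])
  moreover have "(\<Sum>(j, k)\<in>A. e j k / 2) = (\<Sum>(j, k)\<in>A. e j k) / 2"
    by (simp add: sum_divide_distrib case_prod_unfold)
  ultimately show ?thesis unfolding e_def V_def by simp
qed

text \<open>The weighted square function bound, linear in the \<open>A\<^sub>2\<close> constant. It is stated for functions \<open>g\<close>
that are square integrable with respect to \<open>1 / v\<close>, because it is applied to \<open>g = P v\<close> with \<open>P\<close>
square integrable with respect to \<open>v\<close>.\<close>

lemma square_function_estimate:
  assumes v: "weight v" and A2: "A2_const v \<le> ennreal Q" and g: "g \<in> borel_measurable lebesgue"
    and gv: "integrable lebesgue (\<lambda>x. (cmod (g x))\<^sup>2 / v x)" and F: "finite F" "F \<subseteq> dyadic"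
  shows "(\<Sum>J\<in>F. (cmod (L2_inner g (haar J)))\<^sup>2 / mean J v) \<le> 786 * Q * (LINT x|lebesgue. (cmod (g x))\<^sup>2 / v x)"
proof -
  let ?d = "\<lambda>(j, k). dyad j k"
  define A where "A = ?d -` F"
  have inj: "inj ?d" by (auto simp: inj_def dyad_eq_iff)
  have F': "F = ?d ` A" using F(2) unfolding A_def by (auto simp: dyadic_iff image_iff subset_iff)
  have A: "finite A" unfolding A_def using F(1) inj by (intro finite_vimageI)
  show ?thesis
    using square_function_indexed[OF v A2 g gv A]
    unfolding F' by (subst sum.reindex[OF inj_on_subset[OF inj]]) (auto simp: case_prod_unfold)
qed

lemma weight_one: "weight (\<lambda>_. 1)"
  unfolding weight_def set_integrable_def using lmeasurable_compact
  by (auto simp: fmeasurable_def integrable_indicator_iff)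

lemma mean_one: "I \<in> dyadic \<Longrightarrow> mean I (\<lambda>_. 1) = 1"
  using len_dyadic_pos[of I] by (auto simp: mean_def set_lebesgue_integral_def)

lemma A2_const_one: "A2_const (\<lambda>_. 1) \<le> ennreal 1"
proof -
  have "emean I (\<lambda>_. 1) = 1" if "I \<in> dyadic" for I
  proof -
    have "emean I (\<lambda>_. 1) = ennreal (mean I (\<lambda>_. 1))"
      using that by (intro emean_eq_mean weight_set_integrable weight_one) auto
    also have "mean I (\<lambda>_. 1) = 1" using that by (rule mean_one)
    finally show ?thesis by simp
  qed
  then show ?thesis unfolding A2_const_def by (intro SUP_least) simp
qed

text \<open>The square function estimate for the weight \<open>1\<close>. The constant is not the optimal \<open>1\<close>, but it is
numerical.\<close>

lemma Haar_Bessel: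
  assumes f: "f \<in> L2" and F: "finite F" "F \<subseteq> dyadic"
  shows "(\<Sum>I\<in>F. (cmod (L2_inner f (haar I)))\<^sup>2) \<le> 786 * (L2_norm f)\<^sup>2"
proof -
  have m: "mean I (\<lambda>_. 1) = 1" if "I \<in> F" for I
    using that F(2) by (auto intro: mean_one)
  show ?thesis
    using square_function_estimate[OF weight_one A2_const_one, of f F] f F m
    by (simp add: L2_def L2_norm_def)
qed

section \<open>Unconditional convergence in the space of square integrable functions\<close>

lemma summable_small_tails:
  fixes \<phi> :: "'a \<Rightarrow> real"
  assumes sum: "\<phi> summable_on A" and nn: "\<And>a. a \<in> A \<Longrightarrow> 0 \<le> \<phi> a" and \<epsilon>: "\<epsilon> > 0"
  shows "\<exists>F. finite F \<and> F \<subseteq> A \<and> (\<forall>G. finite G \<longrightarrow> G \<subseteq> A - F \<longrightarrow> sum \<phi> G \<le> \<epsilon>)"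
proof -
  have "(sum \<phi> \<longlongrightarrow> infsum \<phi> A) (finite_subsets_at_top A)"
    using has_sum_infsum[OF sum] by (simp add: has_sum_def)
  then have "\<forall>\<^sub>F F in finite_subsets_at_top A. dist (sum \<phi> F) (infsum \<phi> A) < \<epsilon>"
    using \<epsilon> by (rule tendstoD)
  then obtain F where F: "finite F" "F \<subseteq> A" "dist (sum \<phi> F) (infsum \<phi> A) < \<epsilon>"
    unfolding eventually_finite_subsets_at_top by blast
  have "sum \<phi> G \<le> \<epsilon>" if G: "finite G" "G \<subseteq> A - F" for G
  proof -
    have "sum \<phi> F + sum \<phi> G = sum \<phi> (F \<union> G)"
      using F G by (intro sum.union_disjoint[symmetric]) auto
    also have "\<dots> \<le> infsum \<phi> A"
      using F G sum nn by (intro finite_sum_le_infsum) auto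
    finally show ?thesis using F(3) by (simp add: dist_real_def)
  qed
  then show ?thesis using F by blast
qed

lemma L2_norm_square: "(L2_norm f)\<^sup>2 = (LINT x|lebesgue. (cmod (f x))\<^sup>2)"
  unfolding L2_norm_def by simp

lemma nn_integral_square_L2:
  assumes "f \<in> L2" shows "(\<integral>\<^sup>+ x. ennreal ((cmod (f x))\<^sup>2) \<partial>lebesgue) = ennreal ((L2_norm f)\<^sup>2)"
  using assms unfolding L2_def L2_norm_square by (intro nn_integral_eq_integral) auto

lemma L2_if_nn_integral_le:
  assumes m: "f \<in> borel_measurable lebesgue" and B: "0 \<le> B"
    and le: "(\<integral>\<^sup>+ x. ennreal ((cmod (f x))\<^sup>2) \<partial>lebesgue) \<le> ennreal B"
  shows "f \<in> L2" "(L2_norm f)\<^sup>2 \<le> B"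
proof -
  have "integrable lebesgue (\<lambda>x. (cmod (f x))\<^sup>2)"
  proof (rule integrableI_bounded)
    show "(\<integral>\<^sup>+ x. ennreal (norm ((cmod (f x))\<^sup>2)) \<partial>lebesgue) < \<infinity>"
      using le by (simp add: le_less_trans[OF _ ennreal_less_top])
  qed (use m in measurable)
  then show *: "f \<in> L2" using m by (simp add: L2_def)
  show "(L2_norm f)\<^sup>2 \<le> B" using le B unfolding nn_integral_square_L2[OF *] by simp
qed

text \<open>The weight \<open>4\<^sup>k\<close> forces the increments to be at most a constant times \<open>2\<^sup>-\<^sup>k\<close>.\<close>

lemma convergent_if_increments_square_summable:
  fixes S :: "nat \<Rightarrow> complex"
  assumes "(\<Sum>k. ennreal (4 ^ k * (cmod (S (Suc k) - S k))\<^sup>2)) \<noteq> \<infinity>"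
  shows "convergent S"
proof -
  define s where "s = (\<Sum>k. ennreal (4 ^ k * (cmod (S (Suc k) - S k))\<^sup>2))"
  have "s < top" using assms by (simp add: s_def less_top)
  then obtain b where b: "b \<ge> 0" "s = ennreal b" by (cases s) auto
  define B where "B = b + 1"
  have "b \<le> B\<^sup>2" using b(1) by (simp add: B_def power2_eq_square algebra_simps)
  then have sB: "s \<le> ennreal (B\<^sup>2)" using b by (simp add: ennreal_leI)
  have B0: "B > 0" using b by (simp add: B_def)
  have step: "norm (S (Suc k) - S k) \<le> B * (1 / 2) ^ k" for k
  proof -
    have "ennreal (4 ^ k * (cmod (S (Suc k) - S k))\<^sup>2) \<le> ennreal (B\<^sup>2)"
      using sum_le_suminf[OF summableI, of "{k}" "\<lambda>k. ennreal (4 ^ k * (cmod (S (Suc k) - S k))\<^sup>2)"]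
      unfolding s_def[symmetric] by (intro order_trans[OF _ sB]) simp
    then have "4 ^ k * (cmod (S (Suc k) - S k))\<^sup>2 \<le> B\<^sup>2" by (subst (asm) ennreal_le_iff) auto
    moreover have "(4::real) ^ k = (2 ^ k)\<^sup>2" by (simp add: power2_eq_square power_mult_distrib[symmetric])
    ultimately have "(2 ^ k * cmod (S (Suc k) - S k))\<^sup>2 \<le> B\<^sup>2" by (simp add: power_mult_distrib)
    then have "2 ^ k * cmod (S (Suc k) - S k) \<le> B" using B0 by (rule power2_le_imp_le[OF _ less_imp_le])
    then show ?thesis by (simp add: field_simps power_one_over)
  qed
  have "summable (\<lambda>k. B * (1 / 2) ^ k)" by (intro summable_mult summable_geometric) simp
  then have "summable (\<lambda>k. S (Suc k) - S k)" by (rule summable_comparison_test'[where N = 0]) (rule step)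
  then have "convergent (\<lambda>n. (\<Sum>k<n. S (Suc k) - S k) + S 0)"
    by (intro convergent_add convergent_const) (simp add: summable_iff_convergent)
  then show ?thesis by (simp add: sum_lessThan_telescope)
qed

text \<open>This is the completeness of \<open>L\<^sup>2\<close> in the form in which it is used. Along an increasing sequence of
finite sets outside of which \<open>\<phi>\<close> has mass at most \<open>8\<^sup>-\<^sup>k\<close>, the partial sums converge almost
everywhere, and Fatou's lemma carries all norm estimates over to the limit. The limit does not depend on the
sequence: any finite set that contains the \<open>k\<close>-th set of the sequence differs from the later ones only
where \<open>\<phi>\<close> is small.\<close>

lemma has_L2_sum_if_dominated:
  fixes u :: "'a \<Rightarrow> real \<Rightarrow> complex" and \<phi> :: "'a \<Rightarrow> real"
  assumes meas: "\<And>a. a \<in> A \<Longrightarrow> u a \<in> borel_measurable lebesgue"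
    and sum: "\<phi> summable_on A" and nn: "\<And>a. a \<in> A \<Longrightarrow> 0 \<le> \<phi> a"
    and bound: "\<And>F. finite F \<Longrightarrow> F \<subseteq> A \<Longrightarrow>
      (\<integral>\<^sup>+ x. ennreal ((cmod (\<Sum>a\<in>F. u a x))\<^sup>2) \<partial>lebesgue) \<le> ennreal (sum \<phi> F)"
  shows "\<exists>g. has_L2_sum u A g \<and> (L2_norm g)\<^sup>2 \<le> infsum \<phi> A"
proof -
  have "\<forall>k. \<exists>F. finite F \<and> F \<subseteq> A \<and> (\<forall>G. finite G \<longrightarrow> G \<subseteq> A - F \<longrightarrow> sum \<phi> G \<le> (1 / 8) ^ k)"
    using sum nn by (intro allI summable_small_tails) auto
  then obtain H where H: "\<And>k. finite (H k)" "\<And>k. H k \<subseteq> A"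
    "\<And>k G. finite G \<Longrightarrow> G \<subseteq> A - H k \<Longrightarrow> sum \<phi> G \<le> (1 / 8) ^ k"
    by metis
  define F where "F k = (\<Union>i\<le>k. H i)" for k
  have F: "finite (F k)" "F k \<subseteq> A" for k unfolding F_def using H by auto
  have Fmono: "F k \<subseteq> F l" if "k \<le> l" for k l unfolding F_def using that by fastforce
  have Ftail: "sum \<phi> G \<le> (1 / 8) ^ k" if "finite G" "G \<subseteq> A - F k" for G k
    using that H(3)[of G k] unfolding F_def by blast
  define T where "T B x = (\<Sum>a\<in>B. u a x)" for B x
  have Tm: "T B \<in> borel_measurable lebesgue" if "B \<subseteq> A" for B
    unfolding T_def using meas that by (intro borel_measurable_sum) auto
  have tail: "(\<integral>\<^sup>+ x. ennreal ((cmod (T G x))\<^sup>2) \<partial>lebesgue) \<le> ennreal ((1 / 8) ^ k)"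
    if "finite G" "G \<subseteq> A - F k" for G k
    using bound[of G] Ftail[OF that] that unfolding T_def
    by (meson Diff_subset ennreal_leI order_trans)
  define S where "S k = T (F k)" for k
  have Sm[measurable]: "S k \<in> borel_measurable lebesgue" for k unfolding S_def using F Tm by blast
  have Sdiff: "S (Suc k) x - S k x = T (F (Suc k) - F k) x" for k x
    unfolding S_def T_def using F Fmono[of k "Suc k"] by (subst sum_diff) auto
  have "(\<integral>\<^sup>+ x. (\<Sum>k. ennreal (4 ^ k * (cmod (S (Suc k) x - S k x))\<^sup>2)) \<partial>lebesgue)
      = (\<Sum>k. \<integral>\<^sup>+ x. ennreal (4 ^ k * (cmod (S (Suc k) x - S k x))\<^sup>2) \<partial>lebesgue)"
    by (rule nn_integral_suminf) measurable
  \<comment> \<open>The squared norms of the increments are at most \<open>8\<^sup>-\<^sup>k\<close>, which leaves \<open>2\<^sup>-\<^sup>k\<close> after weighting.\<close>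
  also have "\<dots> \<le> (\<Sum>k. ennreal ((1 / 2) ^ k))"
  proof (rule suminf_le)
    fix k
    have "(\<integral>\<^sup>+ x. ennreal (4 ^ k * (cmod (S (Suc k) x - S k x))\<^sup>2) \<partial>lebesgue)
        = ennreal (4 ^ k) * (\<integral>\<^sup>+ x. ennreal ((cmod (S (Suc k) x - S k x))\<^sup>2) \<partial>lebesgue)"
      by (subst nn_integral_cmult[symmetric]) (auto simp: ennreal_mult)
    also have "\<dots> \<le> ennreal (4 ^ k) * ennreal ((1 / 8) ^ k)"
      unfolding Sdiff by (intro mult_left_mono tail) (use F in auto)
    also have "\<dots> = ennreal ((1 / 2) ^ k)"
      by (simp add: ennreal_mult[symmetric] power_mult_distrib[symmetric])
    finally show "(\<integral>\<^sup>+ x. ennreal (4 ^ k * (cmod (S (Suc k) x - S k x))\<^sup>2) \<partial>lebesgue) \<le> ennreal ((1 / 2) ^ k)" .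
  qed auto
  also have "\<dots> = ennreal (\<Sum>k. (1 / 2) ^ k)" by (intro suminf_ennreal2) auto
  also have "\<dots> < \<infinity>" by simp
  finally have "AE x in lebesgue. (\<Sum>k. ennreal (4 ^ k * (cmod (S (Suc k) x - S k x))\<^sup>2)) \<noteq> \<infinity>"
    by (intro nn_integral_PInf_AE) auto
  then have conv: "AE x in lebesgue. convergent (\<lambda>k. S k x)"
    by eventually_elim (rule convergent_if_increments_square_summable)
  define g where "g x = lim (\<lambda>k. S k x)" for x
  have gm[measurable]: "g \<in> borel_measurable lebesgue" unfolding g_def by measurable
  have lim: "AE x in lebesgue. (\<lambda>k. S k x) \<longlonglongrightarrow> g x"
    using conv by eventually_elim (simp add: g_def convergent_LIMSEQ_iff)
  have Fatou: "(\<integral>\<^sup>+ x. ennreal ((cmod (f x - g x))\<^sup>2) \<partial>lebesgue) \<le> ennreal B"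
    if f[measurable]: "f \<in> borel_measurable lebesgue"
      and B: "\<And>l. l \<ge> k \<Longrightarrow> (\<integral>\<^sup>+ x. ennreal ((cmod (f x - S l x))\<^sup>2) \<partial>lebesgue) \<le> ennreal B" for f B and k :: nat
  proof -
    have "(\<integral>\<^sup>+ x. ennreal ((cmod (f x - g x))\<^sup>2) \<partial>lebesgue)
        = (\<integral>\<^sup>+ x. liminf (\<lambda>l. ennreal ((cmod (f x - S l x))\<^sup>2)) \<partial>lebesgue)"
    proof (rule nn_integral_cong_AE, use lim in eventually_elim)
      case (elim x)
      then have "(\<lambda>l. ennreal ((cmod (f x - S l x))\<^sup>2)) \<longlonglongrightarrow> ennreal ((cmod (f x - g x))\<^sup>2)"
        by (intro tendsto_intros)
      then show ?case by (rule lim_imp_Liminf[OF sequentially_bot, symmetric])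
    qed
    also have "\<dots> \<le> liminf (\<lambda>l. \<integral>\<^sup>+ x. ennreal ((cmod (f x - S l x))\<^sup>2) \<partial>lebesgue)"
      by (rule nn_integral_liminf) measurable
    also have "\<dots> \<le> liminf (\<lambda>l. ennreal B)"
      by (intro Liminf_mono eventually_sequentiallyI[of k] B)
    also have "\<dots> = ennreal B" by (simp add: Liminf_const)
    finally show ?thesis .
  qed
  have norm: "(\<integral>\<^sup>+ x. ennreal ((cmod (g x))\<^sup>2) \<partial>lebesgue) \<le> ennreal (infsum \<phi> A)"
  proof -
    have "(\<integral>\<^sup>+ x. ennreal ((cmod (0 - S l x))\<^sup>2) \<partial>lebesgue) \<le> ennreal (infsum \<phi> A)" for l
    proof -
      have "(\<integral>\<^sup>+ x. ennreal ((cmod (0 - S l x))\<^sup>2) \<partial>lebesgue) \<le> ennreal (sum \<phi> (F l))"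
        using bound[OF F] by (simp add: S_def T_def)
      also have "\<dots> \<le> ennreal (infsum \<phi> A)"
        using F[of l] sum nn by (intro ennreal_leI finite_sum_le_infsum) auto
      finally show ?thesis .
    qed
    then show ?thesis using Fatou[of "\<lambda>_. 0" 0 "infsum \<phi> A"] by simp
  qed
  have inf0: "0 \<le> infsum \<phi> A" using nn by (intro infsum_nonneg) auto
  note gL2 = L2_if_nn_integral_le[OF gm inf0 norm]
  have close: "(\<integral>\<^sup>+ x. ennreal ((cmod (T G x - g x))\<^sup>2) \<partial>lebesgue) \<le> ennreal (4 * (1 / 8) ^ k)"
    if G: "finite G" "F k \<subseteq> G" "G \<subseteq> A" for G k
  proof (rule Fatou[of _ k])
    show "T G \<in> borel_measurable lebesgue" using G by (intro Tm)
    fix l assume l: "l \<ge> k"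
    have m[measurable]: "T (G - F l) \<in> borel_measurable lebesgue" "T (F l - G) \<in> borel_measurable lebesgue"
      using G F(2)[of l] by (auto intro!: Tm)
    \<comment> \<open>Both differences avoid \<open>F k\<close>, so each has a small norm.\<close>
    have eq: "T G x - S l x = T (G - F l) x - T (F l - G) x" for x
    proof -
      have "T G x = T (G - F l) x + T (G \<inter> F l) x"
        unfolding T_def using G F by (subst sum.union_disjoint[symmetric]) (auto intro: sum.cong)
      moreover have "S l x = T (F l - G) x + T (G \<inter> F l) x"
        unfolding T_def S_def using G F by (subst sum.union_disjoint[symmetric]) (auto intro: sum.cong)
      ultimately show ?thesis by simp
    qed
    have sq: "(cmod (a - b))\<^sup>2 \<le> 2 * (cmod a)\<^sup>2 + 2 * (cmod b)\<^sup>2" for a b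
    proof -
      have "(cmod (a - b))\<^sup>2 \<le> (cmod a + cmod b)\<^sup>2" by (intro power_mono norm_triangle_ineq4) auto
      also have "\<dots> \<le> 2 * (cmod a)\<^sup>2 + 2 * (cmod b)\<^sup>2"
        using sum_squares_bound[of "cmod a" "cmod b"] by (simp add: power2_sum)
      finally show ?thesis .
    qed
    have two: "ennreal 2 * ennreal y + ennreal 2 * ennreal z = ennreal (2 * y + 2 * z)"
      if "0 \<le> y" "0 \<le> z" for y z
      using that by (subst ennreal_plus) (auto simp: ennreal_mult)
    have "(\<integral>\<^sup>+ x. ennreal ((cmod (T G x - S l x))\<^sup>2) \<partial>lebesgue)
        \<le> (\<integral>\<^sup>+ x. (ennreal 2 * ennreal ((cmod (T (G - F l) x))\<^sup>2) + ennreal 2 * ennreal ((cmod (T (F l - G) x))\<^sup>2)) \<partial>lebesgue)"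
      unfolding eq by (intro nn_integral_mono) (simp only: two zero_le_power2 ennreal_leI sq)
    also have "\<dots> = ennreal 2 * (\<integral>\<^sup>+ x. ennreal ((cmod (T (G - F l) x))\<^sup>2) \<partial>lebesgue)
        + ennreal 2 * (\<integral>\<^sup>+ x. ennreal ((cmod (T (F l - G) x))\<^sup>2) \<partial>lebesgue)"
      by (subst nn_integral_add) (auto simp: nn_integral_cmult)
    also have "\<dots> \<le> ennreal 2 * ennreal ((1 / 8) ^ k) + ennreal 2 * ennreal ((1 / 8) ^ k)"
      using G F(1) F(2)[of l] Fmono[OF l] by (intro add_mono mult_left_mono tail) auto
    also have "\<dots> = ennreal (4 * (1 / 8) ^ k)" by (subst two) auto
    finally show "(\<integral>\<^sup>+ x. ennreal ((cmod (T G x - S l x))\<^sup>2) \<partial>lebesgue) \<le> ennreal (4 * (1 / 8) ^ k)" .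
  qed
  have "((\<lambda>G. \<integral>\<^sup>+ x. ennreal ((cmod (T G x - g x))\<^sup>2) \<partial>lebesgue) \<longlongrightarrow> 0) (finite_subsets_at_top A)"
  proof (rule order_tendstoI)
    fix \<epsilon> :: ennreal assume \<epsilon>: "0 < \<epsilon>"
    have "(\<lambda>k. ennreal (4 * (1 / 8) ^ k)) \<longlonglongrightarrow> ennreal (4 * 0)"
      by (intro tendsto_ennrealI tendsto_mult tendsto_const LIMSEQ_realpow_zero) auto
    then have "\<forall>\<^sub>F k in sequentially. ennreal (4 * (1 / 8) ^ k) < \<epsilon>"
      using \<epsilon> by (auto dest: order_tendstoD(2))
    then obtain k where k: "ennreal (4 * (1 / 8) ^ k) < \<epsilon>" unfolding eventually_sequentially by blast
    show "\<forall>\<^sub>F G in finite_subsets_at_top A. (\<integral>\<^sup>+ x. ennreal ((cmod (T G x - g x))\<^sup>2) \<partial>lebesgue) < \<epsilon>"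
      unfolding eventually_finite_subsets_at_top
      by (intro exI[of _ "F k"] conjI allI impI F le_less_trans[OF close k]) auto
  qed simp
  then have "has_L2_sum u A g" unfolding has_L2_sum_def T_def using gL2(1) by blast
  then show ?thesis using gL2(2) by blast
qed

section \<open>Weighted norms of finite Haar sums\<close>

lemma sum_mean_dyadic_sub:
  assumes v: "weight v" and L: "L \<in> dyadic"
  shows "(\<Sum>J\<in>dyadic_sub m L. len J / len L * mean J v) = mean L v"
proof -
  note D = dyadic_sub_cover[OF L, of m]
  have "(\<Sum>J\<in>dyadic_sub m L. LINT x:J|lebesgue. v x) = (LINT x:\<Union>(dyadic_sub m L)|lebesgue. v x)"
  proof -
    have "(LINT x:(\<Union>J\<in>dyadic_sub m L. J)|lebesgue. v x) = (\<Sum>J\<in>dyadic_sub m L. LINT x:J|lebesgue. v x)"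
      using D v by (intro set_integral_finite_Union)
        (auto simp: disjoint_family_on_def disjoint_def intro!: weight_set_integrable)
    then show ?thesis by simp
  qed
  then have "(\<Sum>J\<in>dyadic_sub m L. LINT x:J|lebesgue. v x) = (LINT x:L|lebesgue. v x)"
    unfolding D(4) .
  moreover have "len J / len L * mean J v = 1 / len L * (LINT x:J|lebesgue. v x)" if "J \<in> dyadic_sub m L" for J
    using len_dyadic_pos[of J] that D(2) by (auto simp: mean_def)
  then have "(\<Sum>J\<in>dyadic_sub m L. len J / len L * mean J v)
      = (\<Sum>J\<in>dyadic_sub m L. 1 / len L * (LINT x:J|lebesgue. v x))"
    by (intro sum.cong) auto
  ultimately show ?thesis by (simp only: sum_distrib_left[symmetric] mean_def)
qed

text \<open>Generations below different intervals share no interval: an interval has only one ancestor of a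
given relative size.\<close>

lemma sum_dyadic_sub_reindex:
  fixes \<psi> :: "real set \<Rightarrow> real"
  assumes F: "finite F" "F \<subseteq> dyadic"
  shows "(\<Sum>L\<in>F. \<Sum>J\<in>dyadic_sub m L. \<psi> J) = (\<Sum>J\<in>(\<Union>L\<in>F. dyadic_sub m L). \<psi> J)"
proof (rule sum.UNION_disjoint[symmetric])
  show "\<forall>L\<in>F. \<forall>L'\<in>F. L \<noteq> L' \<longrightarrow> dyadic_sub m L \<inter> dyadic_sub m L' = {}"
    using F(2) dyadic_sub_inj by blast
qed (use F dyadic_sub_cover(1) in auto)

text \<open>Splitting each factor \<open>sqrt (len J / len L)\<close> with the square root of the mean of \<open>v\<close> over \<open>J\<close> lets
the first factors sum to the mean of \<open>v\<close> over \<open>L\<close>, whatever the depth \<open>m\<close> of the generation is.\<close>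

lemma haar_coefficients_weighted_Cauchy_Schwarz:
  fixes \<gamma> :: "real set \<Rightarrow> real"
  assumes v: "weight v" and L: "L \<in> dyadic"
  shows "(\<Sum>J\<in>dyadic_sub m L. sqrt (len J / len L) * \<gamma> J)
    \<le> sqrt (mean L v) * sqrt (\<Sum>J\<in>dyadic_sub m L. (\<gamma> J)\<^sup>2 / mean J v)"
proof -
  have pos: "0 < mean J v" "0 < len J" if "J \<in> dyadic_sub m L" for J
  proof -
    have J: "J \<in> dyadic" using that dyadic_sub_cover(2)[OF L] by auto
    show "0 < mean J v"
      using v J by (intro mean_pos weight_set_integrable) (auto simp: weight_def)
    show "0 < len J" using J by (rule len_dyadic_pos)
  qed
  have L0: "0 < len L" using L by (rule len_dyadic_pos)
  have "(\<Sum>J\<in>dyadic_sub m L. sqrt (len J / len L) * \<gamma> J)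
      = (\<Sum>J\<in>dyadic_sub m L. sqrt (len J / len L * mean J v) * (\<gamma> J / sqrt (mean J v)))"
  proof (rule sum.cong[OF refl])
    fix J assume "J \<in> dyadic_sub m L"
    then have "sqrt (mean J v) \<noteq> 0" using pos(1) by fastforce
    then show "sqrt (len J / len L) * \<gamma> J = sqrt (len J / len L * mean J v) * (\<gamma> J / sqrt (mean J v))"
      unfolding real_sqrt_mult[of "len J / len L"] by simp
  qed
  also have "\<dots> \<le> sqrt ((\<Sum>J\<in>dyadic_sub m L. (sqrt (len J / len L * mean J v))\<^sup>2)
      * (\<Sum>J\<in>dyadic_sub m L. (\<gamma> J / sqrt (mean J v))\<^sup>2))"
    by (intro real_le_rsqrt Cauchy_Schwarz_ineq_sum)
  also have "(\<Sum>J\<in>dyadic_sub m L. (sqrt (len J / len L * mean J v))\<^sup>2) = mean L v"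
    unfolding sum_mean_dyadic_sub[OF v L, of m, symmetric]
    using pos L0 by (intro sum.cong) (auto simp: less_imp_le)
  also have "(\<Sum>J\<in>dyadic_sub m L. (\<gamma> J / sqrt (mean J v))\<^sup>2) = (\<Sum>J\<in>dyadic_sub m L. (\<gamma> J)\<^sup>2 / mean J v)"
    using pos by (intro sum.cong) (auto simp: power_divide less_imp_le)
  finally show ?thesis by (simp add: real_sqrt_mult)
qed

lemma borel_measurable_cnj [measurable]:
  "f \<in> borel_measurable M \<Longrightarrow> (\<lambda>x. cnj (f x)) \<in> borel_measurable M"
  by (rule borel_measurable_continuous_on) (intro continuous_intros)

definition L2_weighted :: "(real \<Rightarrow> real) \<Rightarrow> (real \<Rightarrow> complex) set" where
  "L2_weighted v = {P \<in> borel_measurable lebesgue. integrable lebesgue (\<lambda>x. (cmod (P x))\<^sup>2 * v x)}"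

lemma L2_weighted_product_integrable:
  assumes v: "weight v" and P: "P \<in> L2_weighted v" and R: "R \<in> L2_weighted v"
  shows "integrable lebesgue (\<lambda>x. P x * cnj (R x) * complex_of_real (v x))"
proof (rule Bochner_Integration.integrable_bound)
  have [measurable]: "v \<in> borel_measurable lebesgue" using v by (rule weight_measurable)
  have [measurable]: "P \<in> borel_measurable lebesgue" "R \<in> borel_measurable lebesgue"
    using P R by (auto simp: L2_weighted_def)
  show "(\<lambda>x. P x * cnj (R x) * complex_of_real (v x)) \<in> borel_measurable lebesgue" by measurable
  show "integrable lebesgue (\<lambda>x. (cmod (P x))\<^sup>2 * v x + (cmod (R x))\<^sup>2 * v x)"
    using P R by (auto simp: L2_weighted_def)
  have "AE x in lebesgue. 0 < v x" using v by (simp add: weight_def)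
  then show "AE x in lebesgue. norm (P x * cnj (R x) * complex_of_real (v x))
      \<le> norm ((cmod (P x))\<^sup>2 * v x + (cmod (R x))\<^sup>2 * v x)"
  proof eventually_elim
    case (elim x)
    have "cmod (P x) * cmod (R x) \<le> (cmod (P x))\<^sup>2 + (cmod (R x))\<^sup>2"
    proof -
      have "0 \<le> cmod (P x) * cmod (R x)" by simp
      moreover have "2 * (cmod (P x) * cmod (R x)) \<le> (cmod (P x))\<^sup>2 + (cmod (R x))\<^sup>2"
        using sum_squares_bound[of "cmod (P x)" "cmod (R x)"] by (simp add: mult.assoc)
      ultimately show ?thesis by linarith
    qed
    then have "cmod (P x) * cmod (R x) * v x \<le> ((cmod (P x))\<^sup>2 + (cmod (R x))\<^sup>2) * v x"
      using elim by (intro mult_right_mono) auto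
    then show ?case using elim by (simp add: norm_mult distrib_right)
  qed
qed

lemma L2_weighted_add:
  assumes v: "weight v" and P: "P \<in> L2_weighted v" and R: "R \<in> L2_weighted v"
  shows "(\<lambda>x. P x + R x) \<in> L2_weighted v"
proof -
  have [measurable]: "P \<in> borel_measurable lebesgue" "R \<in> borel_measurable lebesgue"
    using P R by (auto simp: L2_weighted_def)
  have "(cmod (P x + R x))\<^sup>2 * v x = (cmod (P x))\<^sup>2 * v x + (cmod (R x))\<^sup>2 * v x
      + 2 * Re (P x * cnj (R x) * complex_of_real (v x))" for x
    unfolding cmod_power2 by (simp add: power2_eq_square algebra_simps)
  moreover have "integrable lebesgue (\<lambda>x. (cmod (P x))\<^sup>2 * v x + (cmod (R x))\<^sup>2 * v x
      + 2 * Re (P x * cnj (R x) * complex_of_real (v x)))"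
    using P R L2_weighted_product_integrable[OF v P R]
    by (intro Bochner_Integration.integrable_add integrable_mult_right integrable_Re) (auto simp: L2_weighted_def)
  ultimately show ?thesis by (simp add: L2_weighted_def)
qed

lemma L2_weighted_scale: "P \<in> L2_weighted v \<Longrightarrow> (\<lambda>x. a * P x) \<in> L2_weighted v"
  by (auto simp: L2_weighted_def norm_mult power_mult_distrib mult.assoc)

lemma L2_weighted_sum:
  assumes v: "weight v" and P: "\<And>i. i \<in> S \<Longrightarrow> P i \<in> L2_weighted v"
  shows "(\<lambda>x. \<Sum>i\<in>S. P i x) \<in> L2_weighted v"
proof (cases "finite S")
  case True
  then show ?thesis using P
  proof (induction S)
    case empty
    show ?case by (simp add: L2_weighted_def)
  next
    case (insert i S)
    then show ?case using L2_weighted_add[OF v, of "P i" "\<lambda>x. \<Sum>i\<in>S. P i x"] by simp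
  qed
qed (simp add: L2_weighted_def)

lemma haar_L2_weighted:
  assumes v: "weight v" and J: "J \<in> dyadic" shows "haar J \<in> L2_weighted v"
proof -
  have "integrable lebesgue (\<lambda>x. indicat_real J x *\<^sub>R v x / len J)"
    using weight_set_integrable[OF v J] by (simp add: set_integrable_def)
  then show ?thesis using J by (simp add: L2_weighted_def norm_haar_square haar_measurable)
qed

text \<open>With \<open>G = P v\<close> the integral \<open>X\<close> of \<open>|P|\<^sup>2 v\<close> equals both the pairing of \<open>P\<close> with \<open>G\<close> and the integral of
\<open>|G|\<^sup>2 / v\<close>. The pairing is bounded by the square function of \<open>G\<close>, which is in turn bounded by
\<open>sqrt X\<close>, and one factor \<open>sqrt X\<close> cancels. Using \<open>P\<close> itself as the test function requires only that
\<open>X\<close> is finite, which holds for a finite Haar sum and a locally integrable \<open>v\<close>.\<close>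

lemma weighted_norm_haar_sum_le:
  fixes c :: "real set \<Rightarrow> real set \<Rightarrow> real set \<Rightarrow> complex" and a :: "real set \<Rightarrow> real"
    and \<alpha> :: "real set \<Rightarrow> complex"
  assumes v: "weight v" and A2: "A2_const v \<le> ennreal Q" and F: "finite F" "F \<subseteq> dyadic"
    and c: "\<And>L I J. L \<in> F \<Longrightarrow> I \<in> dyadic_sub n L \<Longrightarrow> J \<in> dyadic_sub m L \<Longrightarrow>
      cmod (c L I J) \<le> sqrt (len I * len J) / len L"
    and a: "\<And>L. L \<in> F \<Longrightarrow> 0 \<le> a L" "\<And>L. L \<in> F \<Longrightarrow> (a L)\<^sup>2 * mean L v \<le> K"
  defines "P \<equiv> \<lambda>x. \<Sum>L\<in>F. \<Sum>I\<in>dyadic_sub n L. \<Sum>J\<in>dyadic_sub m L.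
      c L I J * complex_of_real (a L) * \<alpha> I * haar J x"
  shows "P \<in> L2_weighted v"
    and "(LINT x|lebesgue. (cmod (P x))\<^sup>2 * v x) \<le> 786 * Q * K * (\<Sum>L\<in>F. \<Sum>I\<in>dyadic_sub n L. (cmod (\<alpha> I))\<^sup>2)"
proof -
  let ?X = "LINT x|lebesgue. (cmod (P x))\<^sup>2 * v x"
  have Jd: "J \<in> dyadic" if "L \<in> F" "J \<in> dyadic_sub k L" for L J k
    using dyadic_sub_cover(2)[of L k] that F(2) by auto
  have h: "haar J \<in> L2_weighted v" if "L \<in> F" "J \<in> dyadic_sub k L" for L J k
    using v Jd[OF that] by (rule haar_L2_weighted)
  show P: "P \<in> L2_weighted v"
    unfolding P_def by (intro L2_weighted_sum L2_weighted_scale v h) auto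
  have vm[measurable]: "v \<in> borel_measurable lebesgue" using v by (rule weight_measurable)
  have Pm[measurable]: "P \<in> borel_measurable lebesgue" using P by (simp add: L2_weighted_def)
  have pos: "AE x in lebesgue. 0 < v x" using v by (simp add: weight_def)
  have X0: "0 \<le> ?X" using pos by (intro integral_nonneg_AE) (auto elim: eventually_mono)
  define G where "G x = P x * complex_of_real (v x)" for x
  have Gm: "G \<in> borel_measurable lebesgue" unfolding G_def by measurable
  have Gv: "AE x in lebesgue. (cmod (G x))\<^sup>2 / v x = (cmod (P x))\<^sup>2 * v x"
    using pos by eventually_elim (simp add: G_def norm_mult power_mult_distrib power2_eq_square)
  have Gi: "integrable lebesgue (\<lambda>x. (cmod (G x))\<^sup>2 / v x)"
    using P Gm by (subst integrable_cong_AE[OF _ _ Gv]) (auto simp: L2_weighted_def)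
  have GX: "(LINT x|lebesgue. (cmod (G x))\<^sup>2 / v x) = ?X"
    using Gm by (intro integral_cong_AE Gv) auto
  define \<phi> where "\<phi> L = (\<Sum>I\<in>dyadic_sub n L. (cmod (\<alpha> I))\<^sup>2)" for L
  define \<psi> where "\<psi> L = (\<Sum>J\<in>dyadic_sub m L. (cmod (L2_inner G (haar J)))\<^sup>2 / mean J v)" for L
  have \<phi>0: "0 \<le> \<phi> L" for L unfolding \<phi>_def by (simp add: sum_nonneg)
  have mp: "0 < mean J v" if "J \<in> dyadic" for J
    using v that by (intro mean_pos weight_set_integrable) (auto simp: weight_def)
  have \<psi>0: "0 \<le> \<psi> L" if "L \<in> F" for L
    unfolding \<psi>_def using mp[OF Jd[OF that]] by (intro sum_nonneg) (auto simp: less_imp_le)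
  define s where "s L = (\<Sum>I\<in>dyadic_sub n L. \<Sum>J\<in>dyadic_sub m L.
      c L I J * complex_of_real (a L) * \<alpha> I * cnj (L2_inner G (haar J)))" for L
  have pair: "(LINT x|lebesgue. haar J x * cnj (G x)) = cnj (L2_inner G (haar J))"
    "integrable lebesgue (\<lambda>x. haar J x * cnj (G x))" if "L \<in> F" "J \<in> dyadic_sub m L" for L J
  proof -
    show "integrable lebesgue (\<lambda>x. haar J x * cnj (G x))"
      using L2_weighted_product_integrable[OF v h[OF that] P] by (simp add: G_def mult.assoc)
    show "(LINT x|lebesgue. haar J x * cnj (G x)) = cnj (L2_inner G (haar J))"
    proof -
      have "cnj (L2_inner G (haar J)) = (LINT x|lebesgue. cnj (G x * cnj (haar J x)))"
        unfolding L2_inner_def by (rule Bochner_Integration.integral_cnj[symmetric])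
      then show ?thesis by (simp add: mult.commute)
    qed
  qed
  have "complex_of_real ?X = (LINT x|lebesgue. P x * cnj (G x))"
  proof -
    have "P x * cnj (G x) = complex_of_real ((cmod (P x))\<^sup>2 * v x)" for x
      unfolding G_def by (simp add: complex_norm_square mult.assoc[symmetric] del: of_real_power)
    then show ?thesis by (simp only: integral_complex_of_real)
  qed
  also have "\<dots> = (LINT x|lebesgue. (\<Sum>L\<in>F. \<Sum>I\<in>dyadic_sub n L. \<Sum>J\<in>dyadic_sub m L.
      c L I J * complex_of_real (a L) * \<alpha> I * (haar J x * cnj (G x))))"
    unfolding P_def by (simp add: sum_distrib_right mult.assoc)
  also have "\<dots> = (\<Sum>L\<in>F. s L)"
    unfolding s_def using pair
    by (subst Bochner_Integration.integral_sum, auto intro!: Bochner_Integration.integrable_sum sum.cong)+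
  finally have "?X = cmod (\<Sum>L\<in>F. s L)" using X0 by (metis abs_of_nonneg norm_of_real)
  also have "\<dots> \<le> (\<Sum>L\<in>F. cmod (s L))" by (rule norm_sum)
  also have "\<dots> \<le> (\<Sum>L\<in>F. sqrt K * (sqrt (\<phi> L) * sqrt (\<psi> L)))"
  proof (rule sum_mono)
    fix L assume L: "L \<in> F"
    have Ld: "L \<in> dyadic" and L0: "0 < len L" using L F(2) len_dyadic_pos by auto
    have "cmod (s L) \<le> (\<Sum>I\<in>dyadic_sub n L. \<Sum>J\<in>dyadic_sub m L.
        cmod (c L I J * complex_of_real (a L) * \<alpha> I * cnj (L2_inner G (haar J))))"
      unfolding s_def by (intro order_trans[OF norm_sum] sum_mono norm_sum)
    also have "\<dots> \<le> (\<Sum>I\<in>dyadic_sub n L. \<Sum>J\<in>dyadic_sub m L.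
        a L * (sqrt (len I / len L) * cmod (\<alpha> I)) * (sqrt (len J / len L) * cmod (L2_inner G (haar J))))"
    proof (intro sum_mono)
      fix I J assume IJ: "I \<in> dyadic_sub n L" "J \<in> dyadic_sub m L"
      have "sqrt (len I * len J) / len L = sqrt (len I / len L) * sqrt (len J / len L)"
        using L0 by (simp add: real_sqrt_mult real_sqrt_divide)
      then have "cmod (c L I J) * (a L * cmod (\<alpha> I) * cmod (L2_inner G (haar J)))
          \<le> sqrt (len I / len L) * sqrt (len J / len L) * (a L * cmod (\<alpha> I) * cmod (L2_inner G (haar J)))"
        using c[OF L IJ] a(1)[OF L] by (intro mult_right_mono) auto
      then show "cmod (c L I J * complex_of_real (a L) * \<alpha> I * cnj (L2_inner G (haar J)))
          \<le> a L * (sqrt (len I / len L) * cmod (\<alpha> I)) * (sqrt (len J / len L) * cmod (L2_inner G (haar J)))"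
        using a(1)[OF L] by (simp add: norm_mult mult_ac)
    qed
    also have "\<dots> = a L * (\<Sum>I\<in>dyadic_sub n L. sqrt (len I / len L) * cmod (\<alpha> I))
        * (\<Sum>J\<in>dyadic_sub m L. sqrt (len J / len L) * cmod (L2_inner G (haar J)))"
      unfolding mult.assoc sum_product unfolding sum_distrib_left by (simp only: mult.assoc)
    also have "\<dots> \<le> a L * sqrt (\<phi> L) * (sqrt (mean L v) * sqrt (\<psi> L))"
    proof (intro mult_mono)
      have "(\<Sum>I\<in>dyadic_sub n L. sqrt (len I / len L) * cmod (\<alpha> I))
          \<le> sqrt (mean L (\<lambda>_. 1)) * sqrt (\<Sum>I\<in>dyadic_sub n L. (cmod (\<alpha> I))\<^sup>2 / mean I (\<lambda>_. 1))"
        by (rule haar_coefficients_weighted_Cauchy_Schwarz[OF weight_one Ld])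
      also have "\<dots> = sqrt (\<phi> L)"
      proof -
        have "(\<Sum>I\<in>dyadic_sub n L. (cmod (\<alpha> I))\<^sup>2 / mean I (\<lambda>_. 1)) = \<phi> L"
          unfolding \<phi>_def using Jd[OF L] by (intro sum.cong) (simp_all add: mean_one)
        then show ?thesis by (simp add: mean_one Ld)
      qed
      finally show "(\<Sum>I\<in>dyadic_sub n L. sqrt (len I / len L) * cmod (\<alpha> I)) \<le> sqrt (\<phi> L)" .
      show "(\<Sum>J\<in>dyadic_sub m L. sqrt (len J / len L) * cmod (L2_inner G (haar J)))
          \<le> sqrt (mean L v) * sqrt (\<psi> L)"
        unfolding \<psi>_def by (rule haar_coefficients_weighted_Cauchy_Schwarz[OF v Ld])
    qed (use a(1)[OF L] \<phi>0 in \<open>auto intro!: sum_nonneg\<close>)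
    also have "\<dots> = sqrt ((a L)\<^sup>2 * mean L v) * (sqrt (\<phi> L) * sqrt (\<psi> L))"
      using a(1)[OF L] by (simp add: real_sqrt_mult)
    also have "\<dots> \<le> sqrt K * (sqrt (\<phi> L) * sqrt (\<psi> L))"
      using a(2)[OF L] \<phi>0 \<psi>0[OF L] by (intro mult_right_mono) auto
    finally show "cmod (s L) \<le> sqrt K * (sqrt (\<phi> L) * sqrt (\<psi> L))" .
  qed
  also have "\<dots> = sqrt K * (\<Sum>L\<in>F. sqrt (\<phi> L) * sqrt (\<psi> L))" by (simp add: sum_distrib_left)
  finally have X1: "?X \<le> sqrt K * (\<Sum>L\<in>F. sqrt (\<phi> L) * sqrt (\<psi> L))" .
  have \<psi>sum: "(\<Sum>L\<in>F. \<psi> L) \<le> 786 * Q * ?X"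
  proof -
    have "finite (\<Union>L\<in>F. dyadic_sub m L)" "(\<Union>L\<in>F. dyadic_sub m L) \<subseteq> dyadic"
      using F dyadic_sub_cover(1,2) by (auto simp: subset_iff)
    then show ?thesis
      unfolding \<psi>_def sum_dyadic_sub_reindex[OF F] GX[symmetric]
      by (rule square_function_estimate[OF v A2 Gm Gi])
  qed
  show "?X \<le> 786 * Q * K * (\<Sum>L\<in>F. \<Sum>I\<in>dyadic_sub n L. (cmod (\<alpha> I))\<^sup>2)"
  proof (cases "F = {}")
    case True
    then show ?thesis by (simp add: P_def)
  next
    case False
    then obtain L where L: "L \<in> F" by auto
    have K0: "0 \<le> K" using a(2)[OF L] mp[of L] L F(2) by (smt (verit) mult_nonneg_nonneg subsetD zero_le_power2)
    have "?X\<^sup>2 \<le> (sqrt K * (\<Sum>L\<in>F. sqrt (\<phi> L) * sqrt (\<psi> L)))\<^sup>2" using X0 X1 by (rule power_mono[rotated])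
    also have "\<dots> = K * (\<Sum>L\<in>F. sqrt (\<phi> L) * sqrt (\<psi> L))\<^sup>2" using K0 by (simp add: power_mult_distrib)
    also have "\<dots> \<le> K * ((\<Sum>L\<in>F. (sqrt (\<phi> L))\<^sup>2) * (\<Sum>L\<in>F. (sqrt (\<psi> L))\<^sup>2))"
      using K0 by (intro mult_left_mono Cauchy_Schwarz_ineq_sum)
    also have "\<dots> = K * ((\<Sum>L\<in>F. \<phi> L) * (\<Sum>L\<in>F. \<psi> L))" using \<phi>0 \<psi>0 by simp
    also have "\<dots> \<le> K * ((\<Sum>L\<in>F. \<phi> L) * (786 * Q * ?X))"
      using K0 \<phi>0 \<psi>sum by (intro mult_left_mono) (auto intro: sum_nonneg)
    \<comment> \<open>One factor \<open>X\<close> can be cancelled because \<open>X\<close> is finite.\<close>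
    finally have "?X * ?X \<le> (786 * Q * K * (\<Sum>L\<in>F. \<phi> L)) * ?X"
      by (simp add: power2_eq_square mult_ac)
    moreover have "0 \<le> 786 * Q * K * (\<Sum>L\<in>F. \<phi> L)"
    proof -
      have "0 \<le> Q" using A2_weight(5,6)[OF v A2, of L] L F(2) by auto
      then show ?thesis using K0 \<phi>0 by (intro mult_nonneg_nonneg) (auto intro: sum_nonneg)
    qed
    ultimately have "?X \<le> 786 * Q * K * (\<Sum>L\<in>F. \<phi> L)"
      using X0 by (cases "?X = 0") (auto intro: mult_right_le_imp_le[of _ ?X])
    then show ?thesis by (simp add: \<phi>_def)
  qed
qed

section \<open>Boundedness of Haar multipliers\<close>

lemma powr_square: "(x powr t)\<^sup>2 = x powr (2 * t)" for x t :: real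
  by (simp add: power2_eq_square powr_add[symmetric])

lemma haar_mult_term_eq:
  "haar_mult_term t m n w c f L x = complex_of_real (w x powr t) *
    (\<Sum>I\<in>dyadic_sub n L. \<Sum>J\<in>dyadic_sub m L.
      c L I J * complex_of_real (1 / mean L w powr t) * L2_inner f (haar I) * haar J x)"
  unfolding haar_mult_term_def sum_distrib_left by (intro sum.cong refl) simp

lemma haar_mult_term_measurable:
  assumes w: "weight w" and L: "L \<in> dyadic"
  shows "haar_mult_term t m n w c f L \<in> borel_measurable lebesgue"
proof -
  have [measurable]: "w \<in> borel_measurable lebesgue" using w by (rule weight_measurable)
  have [measurable]: "haar J \<in> borel_measurable lebesgue" if "J \<in> dyadic_sub m L" for J
    using that dyadic_sub_cover(2)[OF L] by (intro haar_measurable) auto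
  show ?thesis unfolding haar_mult_term_eq[abs_def] by measurable
qed

text \<open>The condition on \<open>w\<close> is used in the form that the squared factor of the block at \<open>L\<close> times the mean of
\<open>w\<^sup>2\<^sup>t\<close> over \<open>L\<close> is at most \<open>K\<close>.\<close>

lemma haar_multiplier_partial_sum_le:
  fixes w :: "real \<Rightarrow> real" and t :: real
  defines "v \<equiv> \<lambda>x. w x powr (2 * t)"
  assumes w: "weight w" and C: "C_const (2 * t) w \<le> ennreal K" and K: "0 \<le> K"
    and v: "weight v" and A2: "A2_const v \<le> ennreal Q"
    and c: "\<And>L I J. L \<in> dyadic \<Longrightarrow> I \<in> dyadic_sub n L \<Longrightarrow> J \<in> dyadic_sub m L \<Longrightarrow>
      cmod (c L I J) \<le> sqrt (len I * len J) / len L"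
    and F: "finite F" "F \<subseteq> dyadic"
  shows "(\<integral>\<^sup>+ x. ennreal ((cmod (\<Sum>L\<in>F. haar_mult_term t m n w c f L x))\<^sup>2) \<partial>lebesgue)
    \<le> ennreal (\<Sum>L\<in>F. 786 * Q * K * (\<Sum>I\<in>dyadic_sub n L. (cmod (L2_inner f (haar I)))\<^sup>2))"
proof -
  define a where "a L = 1 / mean L w powr t" for L
  define P where "P x = (\<Sum>L\<in>F. \<Sum>I\<in>dyadic_sub n L. \<Sum>J\<in>dyadic_sub m L.
      c L I J * complex_of_real (a L) * L2_inner f (haar I) * haar J x)" for x
  have a: "(a L)\<^sup>2 * mean L v \<le> K" if L: "L \<in> F" for L
  proof -
    have Ld: "L \<in> dyadic" using L F(2) by auto
    have a2: "(a L)\<^sup>2 = mean L w powr (- (2 * t))"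
      unfolding a_def power_divide powr_square by (simp add: powr_minus_divide)
    have "emean L v = ennreal (mean L v)"
      using v Ld by (intro emean_eq_mean weight_set_integrable) (auto simp: v_def)
    moreover have "emean L v * ennreal (mean L w powr (- (2 * t))) \<le> ennreal K"
      using C Ld unfolding C_const_def v_def by (meson SUP_upper order_trans)
    moreover have "0 \<le> mean L v" using A2_weight(3)[OF v A2 Ld] by simp
    ultimately have "ennreal (mean L v * mean L w powr (- (2 * t))) \<le> ennreal K"
      by (simp add: ennreal_mult)
    then show ?thesis using K by (simp add: a2 mult.commute)
  qed
  note bound = weighted_norm_haar_sum_le[where c = c and a = a and \<alpha> = "\<lambda>I. L2_inner f (haar I)"
      and n = n and m = m and K = K, OF v A2 F, folded P_def]
  have sq: "(cmod (\<Sum>L\<in>F. haar_mult_term t m n w c f L x))\<^sup>2 = (cmod (P x))\<^sup>2 * v x" for x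
  proof -
    have "(\<Sum>L\<in>F. haar_mult_term t m n w c f L x) = complex_of_real (w x powr t) * P x"
      unfolding haar_mult_term_eq P_def a_def by (simp add: sum_distrib_left)
    then show ?thesis by (simp add: norm_mult power_mult_distrib powr_square v_def)
  qed
  have cF: "cmod (c L I J) \<le> sqrt (len I * len J) / len L"
    if "L \<in> F" "I \<in> dyadic_sub n L" "J \<in> dyadic_sub m L" for L I J
    using c that F(2) by auto
  have a0: "0 \<le> a L" for L by (simp add: a_def)
  have "(\<lambda>x. P x) \<in> L2_weighted v" using bound(1)[OF cF a0 a] by simp
  then have "(\<integral>\<^sup>+ x. ennreal ((cmod (P x))\<^sup>2 * v x) \<partial>lebesgue) = ennreal (LINT x|lebesgue. (cmod (P x))\<^sup>2 * v x)"
    by (intro nn_integral_eq_integral) (auto simp: L2_weighted_def v_def)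
  also have "\<dots> \<le> ennreal (786 * Q * K * (\<Sum>L\<in>F. \<Sum>I\<in>dyadic_sub n L. (cmod (L2_inner f (haar I)))\<^sup>2))"
    using bound(2)[OF cF a0 a] by (intro ennreal_leI) simp
  finally show ?thesis unfolding sq by (simp add: sum_distrib_left)
qed

lemma haar_multiplier_bounded:
  fixes w :: "real \<Rightarrow> real" and t :: real
  defines "v \<equiv> \<lambda>x. w x powr (2 * t)"
  assumes C: "w \<in> Cd (2 * t)" and A2: "v \<in> A2d"
    and c: "\<And>L I J. L \<in> dyadic \<Longrightarrow> I \<in> dyadic_sub n L \<Longrightarrow> J \<in> dyadic_sub m L \<Longrightarrow>
      cmod (c L I J) \<le> sqrt (len I * len J) / len L"
  shows "haar_mult_bounded_by t m n w c
    (786 * sqrt (enn2real (C_const (2 * t) w)) * sqrt (enn2real (A2_const v)))"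
  unfolding haar_mult_bounded_by_def
proof
  fix f assume f: "f \<in> L2"
  define K where "K = enn2real (C_const (2 * t) w)"
  define Q where "Q = enn2real (A2_const v)"
  have w: "weight w" and v: "weight v" using C A2 by (auto simp: Cd_def A2d_def)
  have K: "0 \<le> K" "C_const (2 * t) w \<le> ennreal K" using C by (auto simp: K_def Cd_def)
  have Q: "0 \<le> Q" "A2_const v \<le> ennreal Q" using A2 by (auto simp: Q_def A2d_def)
  define \<phi> where "\<phi> L = 786 * Q * K * (\<Sum>I\<in>dyadic_sub n L. (cmod (L2_inner f (haar I)))\<^sup>2)" for L
  have \<phi>0: "0 \<le> \<phi> L" for L unfolding \<phi>_def using K Q by (simp add: sum_nonneg)
  have \<phi>F: "sum \<phi> F \<le> 786 * Q * K * (786 * (L2_norm f)\<^sup>2)" if F: "finite F" "F \<subseteq> dyadic" for F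
  proof -
    have "(\<Sum>L\<in>F. \<Sum>I\<in>dyadic_sub n L. (cmod (L2_inner f (haar I)))\<^sup>2) \<le> 786 * (L2_norm f)\<^sup>2"
      unfolding sum_dyadic_sub_reindex[OF F]
      using F dyadic_sub_cover(1,2) by (intro Haar_Bessel f) (auto simp: subset_iff)
    then show ?thesis
      unfolding \<phi>_def sum_distrib_left[symmetric] using K Q by (intro mult_left_mono) auto
  qed
  have sum: "\<phi> summable_on dyadic"
    using \<phi>0 \<phi>F by (intro nonneg_bdd_above_summable_on bdd_aboveI2) auto
  obtain g where g: "has_L2_sum (haar_mult_term t m n w c f) dyadic g" "(L2_norm g)\<^sup>2 \<le> infsum \<phi> dyadic"
    using has_L2_sum_if_dominated[of dyadic "haar_mult_term t m n w c f" \<phi>]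
      haar_mult_term_measurable[OF w] sum \<phi>0
      haar_multiplier_partial_sum_le[where n = n and m = m and c = c and f = f,
        OF w K(2,1) v[unfolded v_def] Q(2)[unfolded v_def] c]
    unfolding \<phi>_def by blast
  have "(L2_norm g)\<^sup>2 \<le> 786 * Q * K * (786 * (L2_norm f)\<^sup>2)"
    using g(2) infsum_le_finite_sums[OF sum \<phi>F] by linarith
  also have "\<dots> = (786 * sqrt K * sqrt Q * L2_norm f)\<^sup>2"
    using K Q by (simp add: power_mult_distrib)
  finally have "L2_norm g \<le> 786 * sqrt K * sqrt Q * L2_norm f"
    by (rule power2_le_imp_le) (use K Q in \<open>auto simp: L2_norm_def\<close>)
  then show "\<exists>g. haar_mult t m n w c f g \<and>
      L2_norm g \<le> 786 * sqrt (enn2real (C_const (2 * t) w)) * sqrt (enn2real (A2_const v)) * L2_norm f"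
    using g(1) unfolding haar_mult_def K_def Q_def by blast
qed

section \<open>Necessity of the condition on the weight\<close>

text \<open>A dyadic interval shorter than another one lies in one of its halves or is disjoint from it.\<close>

lemma haar_constant_on_smaller:
  assumes "j < j'"
  shows "\<exists>\<kappa>. \<forall>x\<in>dyad j' k'. haar (dyad j k) x = \<kappa>"
proof -
  define n where "n = nat (j' - (j + 1))"
  have j': "j' = (j + 1) + int n" using assms by (simp add: n_def)
  \<comment> \<open>The ancestor of the smaller interval that has the size of the halves of the larger one.\<close>
  define l where "l = k' div 2 ^ n"
  have "l * 2 ^ n + k' mod 2 ^ n = k'" unfolding l_def by (rule div_mult_mod_eq)
  moreover have "0 \<le> k' mod 2 ^ n" "k' mod 2 ^ n < 2 ^ n" by auto
  ultimately have "k' \<in> {l * 2 ^ n ..< (l + 1) * 2 ^ n}" unfolding atLeastLessThan_iff distrib_right by linarith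
  then have sub: "dyad j' k' \<subseteq> dyad (j + 1) l" unfolding dyad_eq_UN[of "j + 1" l n] j' by blast
  then show ?thesis
    unfolding haar_dyad indicator_def by (auto simp: mem_dyad subset_iff)
qed

lemma haar_outside: "I \<in> dyadic \<Longrightarrow> x \<notin> I \<Longrightarrow> haar I x = 0"
  using norm_haar_square[of I x] by simp

lemma haar_in_L2: 
  assumes "I \<in> dyadic" shows "haar I \<in> L2" "L2_norm (haar I) = 1"
proof -
  have i: "integrable lebesgue (indicat_real I)"
    using assms emeasure_dyadic_finite[OF assms] by (simp add: integrable_indicator_iff less_top)
  show "haar I \<in> L2"
    unfolding L2_def using assms i by (simp add: haar_measurable norm_haar_square)
  show "L2_norm (haar I) = 1"
    unfolding L2_norm_def using assms i len_dyadic_pos[OF assms] by (simp add: norm_haar_square)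
qed

lemma haar_orthogonal_smaller:
  assumes "j < j'"
  shows "(LINT x|lebesgue. haar (dyad j k) x * haar (dyad j' k') x) = 0"
proof -
  obtain \<kappa> where \<kappa>: "\<forall>x\<in>dyad j' k'. haar (dyad j k) x = \<kappa>"
    using haar_constant_on_smaller[OF assms, where k = k and k' = k'] by (rule exE)
  have "haar (dyad j k) x * haar (dyad j' k') x = \<kappa> * haar (dyad j' k') x" for x
    using \<kappa> haar_outside[of "dyad j' k'" x] by (cases "x \<in> dyad j' k'") auto
  moreover have "(LINT x|lebesgue. haar (dyad j' k') x) = 0"
  proof -
    have i: "integrable lebesgue (indicat_real (dyad (j' + 1) l))" for l
      using emeasure_dyadic_finite[OF dyad_in_dyadic] by (simp add: integrable_indicator_iff less_top)
    have "(LINT x|lebesgue. indicat_real (dyad (j' + 1) (2 * k' + 1)) x - indicat_real (dyad (j' + 1) (2 * k')) x) = 0"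
      using i by (simp add: len_dyad)
    then show ?thesis
      unfolding haar_dyad integral_complex_of_real by simp
  qed
  ultimately show ?thesis by (simp only: integral_mult_right_zero mult_zero_right)
qed

lemma haar_orthonormal:
  assumes "I \<in> dyadic" "I' \<in> dyadic"
  shows "L2_inner (haar I) (haar I') = (if I = I' then 1 else 0)"
proof -
  obtain j k where I: "I = dyad j k" using assms(1) dyadic_iff by blast
  obtain j' k' where I': "I' = dyad j' k'" using assms(2) dyadic_iff by blast
  show ?thesis
  proof (cases "I = I'")
    case True
    have "haar I x * haar I x = complex_of_real ((cmod (haar I x))\<^sup>2)" for x
      using complex_norm_square[of "haar I x"] by simp
    then have "L2_inner (haar I) (haar I) = complex_of_real ((L2_norm (haar I))\<^sup>2)"
      unfolding L2_inner_def L2_norm_square cnj_haar by (simp only: integral_complex_of_real)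
    then show ?thesis using True haar_in_L2(2)[OF assms(1)] by simp
  next
    case False
    consider "j < j'" | "j' < j" | "j = j'" by linarith
    then have "(LINT x|lebesgue. haar I x * haar I' x) = 0"
    proof cases
      case 1
      then show ?thesis unfolding I I' by (rule haar_orthogonal_smaller)
    next
      case 2
      then show ?thesis unfolding I I' by (subst mult.commute) (rule haar_orthogonal_smaller)
    next
      case 3
      then have "I \<inter> I' = {}" using False I I' dyad_disjoint[of k k' j] by auto
      then have "haar I x * haar I' x = 0" for x
        using haar_outside[OF assms(1), of x] haar_outside[OF assms(2), of x] by auto
      then show ?thesis by (simp only: Bochner_Integration.integral_zero)
    qed
    then show ?thesis using False by (simp add: L2_inner_def)
  qed
qed

text \<open>The normalised Haar functions of one generation have modulus one on disjoint supports that
cover \<open>L\<close>.\<close>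

lemma norm_sum_haar_generation:
  assumes L: "L \<in> dyadic"
  shows "(cmod (\<Sum>J\<in>dyadic_sub m L. complex_of_real (sqrt (len J)) * haar J x))\<^sup>2 = indicator L x"
proof (cases "x \<in> L")
  case True
  note D = dyadic_sub_cover[OF L, of m]
  obtain J where J: "J \<in> dyadic_sub m L" "x \<in> J" using True D(4) by blast
  have "haar J' x = 0" if "J' \<in> dyadic_sub m L - {J}" for J'
    using that D(2,3) J by (intro haar_outside) (auto simp: disjoint_def)
  then have "(\<Sum>J\<in>dyadic_sub m L. complex_of_real (sqrt (len J)) * haar J x) = complex_of_real (sqrt (len J)) * haar J x"
    using J(1) D(1) by (subst sum.remove[of _ J]) auto
  moreover have "J \<in> dyadic" using J D(2) by auto
  ultimately show ?thesis
    using True J(2) len_dyadic_pos[of J] by (simp add: norm_mult power_mult_distrib norm_haar_square)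
next
  case False
  have "haar J x = 0" if "J \<in> dyadic_sub m L" for J
    using that dyadic_sub_cover(2,4)[OF L, of m] False by (intro haar_outside) auto
  then show ?thesis using False by simp
qed

text \<open>The finite sets that contain \<open>a\<close> all have the same partial sum, so the limit agrees with it almost
everywhere.\<close>

lemma has_L2_sum_single:
  assumes sum: "has_L2_sum u A g" and a: "a \<in> A" "u a \<in> borel_measurable lebesgue"
    and zero: "\<And>b x. b \<in> A \<Longrightarrow> b \<noteq> a \<Longrightarrow> u b x = 0"
  shows "(\<integral>\<^sup>+ x. ennreal ((cmod (u a x))\<^sup>2) \<partial>lebesgue) = ennreal ((L2_norm g)\<^sup>2)"
proof -
  have g: "g \<in> L2" using sum by (simp add: has_L2_sum_def)
  have m: "g \<in> borel_measurable lebesgue" using g by (simp add: L2_def)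
  let ?d = "\<integral>\<^sup>+ x. ennreal ((cmod (u a x - g x))\<^sup>2) \<partial>lebesgue"
  have "\<forall>\<^sub>F F in finite_subsets_at_top A.
      (\<integral>\<^sup>+ x. ennreal ((cmod ((\<Sum>b\<in>F. u b x) - g x))\<^sup>2) \<partial>lebesgue) = ?d"
    unfolding eventually_finite_subsets_at_top
  proof (intro exI[of _ "{a}"] conjI allI impI)
    fix F assume F: "finite F \<and> {a} \<subseteq> F \<and> F \<subseteq> A"
    then have "(\<Sum>b\<in>F. u b x) = u a x" for x
      using zero by (subst sum.remove[of _ a]) (auto intro!: sum.neutral)
    then show "(\<integral>\<^sup>+ x. ennreal ((cmod ((\<Sum>b\<in>F. u b x) - g x))\<^sup>2) \<partial>lebesgue) = ?d" by simp
  qed (use a in auto)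
  then have "((\<lambda>F. \<integral>\<^sup>+ x. ennreal ((cmod ((\<Sum>b\<in>F. u b x) - g x))\<^sup>2) \<partial>lebesgue) \<longlongrightarrow> ?d)
      (finite_subsets_at_top A)"
    by (rule tendsto_eventually)
  then have "?d = 0"
    using sum unfolding has_L2_sum_def by (blast intro: tendsto_unique[OF finite_subsets_at_top_neq_bot])
  then have "AE x in lebesgue. u a x = g x"
    using a(2) m by (subst (asm) nn_integral_0_iff_AE) auto
  then have "(\<integral>\<^sup>+ x. ennreal ((cmod (u a x))\<^sup>2) \<partial>lebesgue) = (\<integral>\<^sup>+ x. ennreal ((cmod (g x))\<^sup>2) \<partial>lebesgue)"
    by (intro nn_integral_cong_AE) (auto elim: eventually_mono)
  then show ?thesis using nn_integral_square_L2[OF g] by simp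
qed

text \<open>The test function is \<open>h\<^sub>I\<close> for one \<open>I\<close> in the \<open>n\<close>-th generation below \<open>L\<close>. Its image has squared
norm \<open>2\<^sup>-\<^sup>n\<close> times the quantity whose supremum over \<open>L\<close> is the constant of \<open>w\<close>. The resulting
bound depends on \<open>n\<close> but not on \<open>L\<close>.\<close>

lemma Cd_necessary:
  assumes w: "weight w"
    and c: "\<And>L I J. L \<in> dyadic \<Longrightarrow> I \<in> dyadic_sub n L \<Longrightarrow> J \<in> dyadic_sub m L \<Longrightarrow>
      c L I J = complex_of_real (sqrt (len I * len J) / len L)"
    and bounded: "haar_mult_bounded_by t m n w c K"
  shows "w \<in> Cd (2 * t)"
proof -
  have "emean L (\<lambda>x. w x powr (2 * t)) * ennreal (mean L w powr (- (2 * t))) \<le> ennreal (2 ^ n * K\<^sup>2)"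
    if L: "L \<in> dyadic" for L
  proof -
    note D = dyadic_sub_cover[OF L, of n]
    have L0: "0 < len L" using L by (rule len_dyadic_pos)
    have "dyadic_sub n L \<noteq> {}" using D(4) L0 by auto
    then obtain I where I: "I \<in> dyadic_sub n L" by blast
    have Id: "I \<in> dyadic" using I D(2) by blast
    let ?u = "haar_mult_term t m n w c (haar I)"
    obtain g where g: "has_L2_sum ?u dyadic g" "L2_norm g \<le> K"
      using bounded haar_in_L2[OF Id] unfolding haar_mult_bounded_by_def haar_mult_def by fastforce
    have inner: "L2_inner (haar I) (haar I') = (if I' = I then 1 else 0)"
      if "L' \<in> dyadic" "I' \<in> dyadic_sub n L'" for I' L'
    proof -
      have "I' \<in> dyadic" using that dyadic_sub_cover(2)[OF that(1)] by blast
      then show ?thesis using haar_orthonormal[OF Id, of I'] by (simp add: eq_commute)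
    qed
    have zero: "?u L' x = 0" if "L' \<in> dyadic" "L' \<noteq> L" for L' x
    proof -
      have "I' \<noteq> I" if "I' \<in> dyadic_sub n L'" for I'
        using dyadic_sub_inj[OF L \<open>L' \<in> dyadic\<close> I] that \<open>L' \<noteq> L\<close> by blast
      then show ?thesis unfolding haar_mult_term_def using inner[OF \<open>L' \<in> dyadic\<close>] by simp
    qed
    define M where "M = mean L w powr (- (2 * t))"
    have M: "1 / (mean L w powr t)\<^sup>2 = M"
      unfolding M_def powr_square by (simp add: powr_minus_divide)
    have uL: "(cmod (?u L x))\<^sup>2 = M * (1 / 2) ^ n / len L * (w x powr (2 * t) * indicator L x)" for x
    proof -
      have "?u L x = (\<Sum>J\<in>dyadic_sub m L.
          c L I J * complex_of_real (w x powr t / mean L w powr t) * haar J x)"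
        unfolding haar_mult_term_def using I D(1) inner[OF L]
        by (subst sum.remove[of _ I]) (auto intro!: sum.neutral)
      also have "\<dots> = complex_of_real (w x powr t / mean L w powr t * (sqrt (len I) / len L)) *
          (\<Sum>J\<in>dyadic_sub m L. complex_of_real (sqrt (len J)) * haar J x)"
        unfolding sum_distrib_left by (intro sum.cong refl) (simp add: c[OF L I] real_sqrt_mult mult_ac)
      finally have "(cmod (?u L x))\<^sup>2
          = (w x powr t / mean L w powr t * (sqrt (len I) / len L))\<^sup>2 * indicator L x"
        by (simp only: norm_mult power_mult_distrib norm_sum_haar_generation[OF L] norm_of_real power2_abs)
      also have "(w x powr t / mean L w powr t * (sqrt (len I) / len L))\<^sup>2
          = w x powr (2 * t) * (1 / (mean L w powr t)\<^sup>2) * (len I / (len L)\<^sup>2)"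
        using len_dyadic_pos[OF Id] by (simp add: power_mult_distrib power_divide powr_square)
      also have "len I / (len L)\<^sup>2 = (1 / 2) ^ n / len L"
        using len_dyadic_sub[OF I] L0 by (simp add: power2_eq_square)
      finally show ?thesis unfolding M by simp
    qed
    have [measurable]: "w \<in> borel_measurable lebesgue" using w by (rule weight_measurable)
    let ?X = "\<integral>\<^sup>+ x\<in>L. ennreal (w x powr (2 * t)) \<partial>lebesgue"
    have M0: "0 \<le> M" by (simp add: M_def)
    have "ennreal (M * (1 / 2) ^ n / len L) * ?X = (\<integral>\<^sup>+ x. ennreal ((cmod (?u L x))\<^sup>2) \<partial>lebesgue)"
    proof -
      define \<kappa> where "\<kappa> = M * (1 / 2) ^ n / len L"
      have "0 \<le> \<kappa>" using M0 L0 by (simp add: \<kappa>_def)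
      then have "ennreal \<kappa> * (ennreal (w x powr (2 * t)) * indicator L x)
          = ennreal (\<kappa> * (w x powr (2 * t) * indicator L x))" for x
        by (simp add: ennreal_mult indicator_def)
      then show ?thesis
        unfolding uL \<kappa>_def[symmetric] using L by (subst nn_integral_cmult[symmetric]) auto
    qed
    also have "\<dots> = ennreal ((L2_norm g)\<^sup>2)"
      using has_L2_sum_single[OF g(1) L haar_mult_term_measurable[OF w L] zero] by simp
    also have "\<dots> \<le> ennreal (K\<^sup>2)"
      using g(2) by (intro ennreal_leI power_mono) (auto simp: L2_norm_def)
    finally have le: "ennreal (M * (1 / 2) ^ n / len L) * ?X \<le> ennreal (K\<^sup>2)" .
    have "emean L (\<lambda>x. w x powr (2 * t)) * ennreal M = ennreal (1 / len L * M) * ?X"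
    proof -
      have "inverse (ennreal (len L)) = ennreal (1 / len L)"
        using L0 by (simp add: inverse_ennreal inverse_eq_divide)
      moreover have "ennreal (1 / len L * M) = ennreal (1 / len L) * ennreal M"
        using L0 M0 by (intro ennreal_mult) auto
      ultimately show ?thesis unfolding emean_def divide_ennreal_def by (simp only: mult_ac)
    qed
    also have "1 / len L * M = 2 ^ n * (M * (1 / 2) ^ n / len L)"
      by (simp add: power_one_over)
    also have "ennreal (2 ^ n * (M * (1 / 2) ^ n / len L)) * ?X = ennreal (2 ^ n) * (ennreal (M * (1 / 2) ^ n / len L) * ?X)"
      using L0 M0 by (subst ennreal_mult) (auto simp: mult.assoc)
    also have "\<dots> \<le> ennreal (2 ^ n) * ennreal (K\<^sup>2)" using le by (intro mult_left_mono) auto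
    finally show ?thesis unfolding M_def by (simp add: ennreal_mult)
  qed
  then have "C_const (2 * t) w \<le> ennreal (2 ^ n * K\<^sup>2)"
    unfolding C_const_def by (intro SUP_least)
  then show ?thesis using w by (simp add: Cd_def le_less_trans[OF _ ennreal_less_top])
qed

section \<open>Boundedness and necessity together\<close>

lemma haar_mult_bounded_by_mono:
  assumes "haar_mult_bounded_by t m n w c K" "K \<le> K'"
  shows "haar_mult_bounded_by t m n w c K'"
proof -
  have "K * L2_norm f \<le> K' * L2_norm f" for f
    using assms(2) by (intro mult_right_mono) (auto simp: L2_norm_def)
  then show ?thesis using assms(1) unfolding haar_mult_bounded_by_def by (meson order_trans)
qed

theorem theorem1p2:
  "(\<exists>C>0. \<forall>(t::real) (m::nat) (n::nat) (w :: real \<Rightarrow> real)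
        (c :: real set \<Rightarrow> real set \<Rightarrow> real set \<Rightarrow> complex).
      weight w \<longrightarrow>
      (\<forall>L\<in>dyadic. \<forall>I\<in>dyadic_sub n L. \<forall>J\<in>dyadic_sub m L.
         cmod (c L I J) \<le> sqrt (len I * len J) / len L) \<longrightarrow>
      w \<in> Cd (2 * t) \<longrightarrow> (\<lambda>x. w x powr (2 * t)) \<in> A2d \<longrightarrow>
      haar_mult_bounded_by t m n w c
        (C * real (m + n + 2) ^ 3 * sqrt (enn2real (C_const (2 * t) w))
           * sqrt (enn2real (A2_const (\<lambda>x. w x powr (2 * t))))))
   \<and>
   (\<forall>(t::real) (m::nat) (n::nat) (w :: real \<Rightarrow> real)
        (c :: real set \<Rightarrow> real set \<Rightarrow> real set \<Rightarrow> complex).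
      weight w \<longrightarrow>
      (\<forall>L\<in>dyadic. \<forall>I\<in>dyadic_sub n L. \<forall>J\<in>dyadic_sub m L.
         c L I J = complex_of_real (sqrt (len I * len J) / len L)) \<longrightarrow>
      (\<exists>K. haar_mult_bounded_by t m n w c K) \<longrightarrow>
      w \<in> Cd (2 * t))"
proof (intro conjI exI[of _ "786::real"] allI impI)
  fix t :: real and m n :: nat and w :: "real \<Rightarrow> real" and c :: "real set \<Rightarrow> real set \<Rightarrow> real set \<Rightarrow> complex"
  let ?v = "\<lambda>x. w x powr (2 * t)"
  let ?s = "sqrt (enn2real (C_const (2 * t) w)) * sqrt (enn2real (A2_const ?v))"
  assume c: "\<forall>L\<in>dyadic. \<forall>I\<in>dyadic_sub n L. \<forall>J\<in>dyadic_sub m L. cmod (c L I J) \<le> sqrt (len I * len J) / len L"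
    and C: "w \<in> Cd (2 * t)" and A2: "?v \<in> A2d"
  have "786 * ?s * 1 \<le> 786 * ?s * real (m + n + 2) ^ 3"
    by (intro mult_left_mono one_le_power) auto
  then have "786 * sqrt (enn2real (C_const (2 * t) w)) * sqrt (enn2real (A2_const ?v))
      \<le> 786 * real (m + n + 2) ^ 3 * sqrt (enn2real (C_const (2 * t) w)) * sqrt (enn2real (A2_const ?v))"
    by (simp only: mult_ac mult_1_right)
  moreover have "haar_mult_bounded_by t m n w c
      (786 * sqrt (enn2real (C_const (2 * t) w)) * sqrt (enn2real (A2_const ?v)))"
    using c by (intro haar_multiplier_bounded[OF C A2]) blast
  ultimately show "haar_mult_bounded_by t m n w c (786 * real (m + n + 2) ^ 3
      * sqrt (enn2real (C_const (2 * t) w)) * sqrt (enn2real (A2_const ?v)))"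
    by (rule haar_mult_bounded_by_mono[rotated])
next
  fix t :: real and m n :: nat and w :: "real \<Rightarrow> real" and c :: "real set \<Rightarrow> real set \<Rightarrow> real set \<Rightarrow> complex"
  assume "weight w" "\<forall>L\<in>dyadic. \<forall>I\<in>dyadic_sub n L. \<forall>J\<in>dyadic_sub m L.
      c L I J = complex_of_real (sqrt (len I * len J) / len L)" "\<exists>K. haar_mult_bounded_by t m n w c K"
  then show "w \<in> Cd (2 * t)" using Cd_necessary[of w n m c t] by blast
qed simp

end
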